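(* Let $n\ge 1$ and let $d$ be an integer with $0\le d\le n/2$. Then: (1) The map $\tilde{X}':\mathcal{D}_d\to\mathcal{D}_{d-1}$ is surjective. (2) There are direct sum decompositions $\mathcal{D}_d=\bigoplus_{k=0}^{d}\mathcal{D}_d^k=\mathcal{D}_d^0\oplus\tilde{Y}'\mathcal{D}_{d-1}$, where $\mathcal{D}_d^k:=(\tilde{Y}')^k\mathcal{D}^0_{d-k}$ for $k=0,1,\dots,d$. (3) For any nonzero $Q\in\mathcal{D}_d^0$, the space spanned by $\{(\tilde{Y}')^jQ\}_{j=0}^{n-2d}$ is an irreducible $\mathfrak{sl}_2$-module (for the action of $\mathfrak{sl}_2$ through $\tilde{X}',\tilde{H}',\tilde{Y}'$) isomorphic to $V_{n-2d}:=\mathrm{Sym}^{n-2d}(V_1)$. (4) $\dim(\mathcal{D}_d^0)=\dim(\mathcal{D}_d)-\dim(\mathcal{D}_{d-1})=\binom{n}{d}-\binom{n}{d-1}$.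
   Context: Let $V_1=\mathbb{C}^2$ be the defining representation of $\mathfrak{sl}_2$ over $\mathbb{C}$. A function $g:\mathbb{F}_2\to\mathbb{C}$ is identified with the column vector $\binom{g(0)}{g(1)}\in V_1$, and functions $\mathbb{F}_2^n\to\mathbb{C}$ are identified with $V_1^{\otimes n}$: the pure tensor $\binom{g_{10}}{g_{11}}\otimes\cdots\otimes\binom{g_{n0}}{g_{n1}}$ is the function $v\mapsto g_{1v_1}\cdots g_{nv_n}$. Let $\mathcal{D}$ be the space of complex polynomial functions on $\mathbb{F}_2^n$ in $(-1)^{v_1},\dots,(-1)^{v_n}$, and let $\mathcal{D}_d\subset\mathcal{D}$ be the span of the monomials $\prod_{j\in J}(-1)^{v_j}$ with $J\subseteq\{1,\dots,n\}$, $|J|=d$; $\mathcal{D}_d=\{0\}$ for $d<0$. Let $X=\begin{pmatrix}0&1\\0&0\end{pmatrix}$, $H=\begin{pmatrix}1&0\\0&-1\end{pmatrix}$, $Y=\begin{pmatrix}0&0\\1&0\end{pmatrix}$ be the standard basis of $\mathfrak{sl}_2$, $T=\begin{pmatrix}1&1\\1&-1\end{pmatrix}$, and $X'=T^{-1}XT=\tfrac12(H-X+Y)$, $H'=T^{-1}HT=X+Y$, $Y'=T^{-1}YT=\tfrac12(H+X-Y)$. For a $2\times2$ matrix $M$ let $\tilde M=\sum_{j=1}^n I\otimes\cdots\otimes M\otimes\cdots\otimes I$ ($M$ in the $j$-th factor, $I$ the identity matrix elsewhere), acting on $V_1^{\otimes n}$; this defines $\tilde X',\tilde H',\tilde Y'$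 from $X',H',Y'$. They satisfy the commutation relations of $X,H,Y$, so $X\mapsto\tilde X'$, $H\mapsto\tilde H'$, $Y\mapsto\tilde Y'$ makes $V_1^{\otimes n}$ an $\mathfrak{sl}_2$-module. The operator $\tilde X'$ maps $\mathcal{D}_d$ to $\mathcal{D}_{d-1}$, and the space of degree-$d$ discrete harmonic polynomials is $\mathcal{D}_d^0:=\ker(\tilde X':\mathcal{D}_d\to\mathcal{D}_{d-1})$. *)

theory Defs
  imports "HOL-Analysis.Analysis" "HOL-Library.Function_Algebras" "HOL-Library.Z2"
    "HOL-Algebra.Module" "HOL-Algebra.AbelCoset"
begin

section \<open>Functions on \<open>\<bbbF>\<^sub>2\<^sup>n\<close> and the tensor powers of \<open>\<complex>\<^sup>2\<close>\<close>

global_interpretation cfun: vector_space "\<lambda>(c::complex) (f :: 'a \<Rightarrow> complex) x. c * f x"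
  by unfold_locales (auto simp: fun_eq_iff algebra_simps)

text \<open>Points of \<open>\<bbbF>\<^sub>2\<^sup>n\<close> have coordinates indexed by \<open>1, \<dots>, n\<close>; the type \<^typ>\<open>bit\<close> is the field
  \<open>\<bbbF>\<^sub>2\<close>.\<close>

definition F2n :: "nat \<Rightarrow> (nat \<Rightarrow> bit) set" where
  "F2n n = {1..n} \<rightarrow>\<^sub>E UNIV"

text \<open>A function on \<open>\<bbbF>\<^sub>2\<^sup>n\<close> is represented by its extension by zero to all of \<^typ>\<open>nat \<Rightarrow> bit\<close>.\<close>

definition tensor_power :: "nat \<Rightarrow> ((nat \<Rightarrow> bit) \<Rightarrow> complex) set" where
  "tensor_power n = {f. \<forall>v. v \<notin> F2n n \<longrightarrow> f v = 0}"

text \<open>The function \<open>g\<close> on \<open>\<bbbF>\<^sub>2\<close> is the column vector with first entry \<open>g 0\<close> and second entry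
  \<open>g 1\<close>, so \<open>0\<close> and \<open>1\<close> label the positions \<open>1\<close> and \<open>2\<close> of a vector or matrix.\<close>

definition pos :: "bit \<Rightarrow> 2" where
  "pos b = (if b = 0 then 1 else 2)"

definition pure_tensor :: "nat \<Rightarrow> (nat \<Rightarrow> complex^2) \<Rightarrow> (nat \<Rightarrow> bit) \<Rightarrow> complex" where
  "pure_tensor n g v = (if v \<in> F2n n then \<Prod>j\<in>{1..n}. g j $ pos (v j) else 0)"

definition slot :: "nat \<Rightarrow> complex^2^2 \<Rightarrow> ((nat \<Rightarrow> bit) \<Rightarrow> complex) \<Rightarrow> (nat \<Rightarrow> bit) \<Rightarrow> complex" where
  "slot j M f v = (\<Sum>b\<in>{0,1}. M $ pos (v j) $ pos b * f (v(j := b)))"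

definition tilde :: "nat \<Rightarrow> complex^2^2 \<Rightarrow> ((nat \<Rightarrow> bit) \<Rightarrow> complex) \<Rightarrow> (nat \<Rightarrow> bit) \<Rightarrow> complex" where
  "tilde n M f = (\<Sum>j\<in>{1..n}. slot j M f)"

text \<open>\<^const>\<open>slot\<close> is \<open>I \<otimes> \<dots> \<otimes> M \<otimes> \<dots> \<otimes> I\<close> with \<open>M\<close> in the \<open>j\<close>-th factor.\<close>

lemma slot_pure_tensor:
  assumes "j \<in> {1..n}"
  shows "slot j M (pure_tensor n g) = pure_tensor n (g(j := M *v g j))"
proof
  fix v
  have iff: "v(j := b) \<in> F2n n \<longleftrightarrow> v \<in> F2n n" for b
    using assms by (auto simp: F2n_def PiE_iff extensional_def)
  show "slot j M (pure_tensor n g) v = pure_tensor n (g(j := M *v g j)) v"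
  proof (cases "v \<in> F2n n")
    case True
    have 1: "pure_tensor n g (v(j := b)) =
        g j $ pos b * (\<Prod>i\<in>{1..n} - {j}. g i $ pos (v i))" for b
      using assms True iff by (simp add: pure_tensor_def prod.remove[of _ j])
    have 2: "pure_tensor n (g(j := M *v g j)) v =
        (M *v g j) $ pos (v j) * (\<Prod>i\<in>{1..n} - {j}. g i $ pos (v i))"
      using assms True by (simp add: pure_tensor_def prod.remove[of _ j])
    have 3: "(M *v g j) $ p = (\<Sum>b\<in>{0,1}. M $ p $ pos b * g j $ pos b)" for p
      by (simp add: matrix_vector_mult_def UNIV_2 pos_def)
    show ?thesis
      unfolding slot_def 1 2 3 by (simp add: algebra_simps)
  qed (simp add: slot_def pure_tensor_def iff)
qed

section \<open>Discrete polynomials and discrete harmonic polynomials\<close>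

definition monomial_fun :: "nat \<Rightarrow> nat set \<Rightarrow> (nat \<Rightarrow> bit) \<Rightarrow> complex" where
  "monomial_fun n J v = (if v \<in> F2n n then \<Prod>j\<in>J. (-1) ^ (if v j = 0 then 0 else 1) else 0)"

definition Dsp :: "nat \<Rightarrow> int \<Rightarrow> ((nat \<Rightarrow> bit) \<Rightarrow> complex) set" where
  "Dsp n d = cfun.span {monomial_fun n J | J. J \<subseteq> {1..n} \<and> int (card J) = d}"

definition matX :: "complex^2^2" where "matX = vector [vector [0, 1], vector [0, 0]]"
definition matH :: "complex^2^2" where "matH = vector [vector [1, 0], vector [0, -1]]"
definition matY :: "complex^2^2" where "matY = vector [vector [0, 0], vector [1, 0]]"
definition matT :: "complex^2^2" where "matT = vector [vector [1, 1], vector [1, -1]]"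

definition primed :: "complex^2^2 \<Rightarrow> complex^2^2" where
  "primed M = matrix_inv matT ** M ** matT"

definition tilde_primed ::
    "nat \<Rightarrow> complex^2^2 \<Rightarrow> ((nat \<Rightarrow> bit) \<Rightarrow> complex) \<Rightarrow> (nat \<Rightarrow> bit) \<Rightarrow> complex" where
  "tilde_primed n M = tilde n (primed M)"

definition Dharm :: "nat \<Rightarrow> int \<Rightarrow> ((nat \<Rightarrow> bit) \<Rightarrow> complex) set" where
  "Dharm n d = {Q \<in> Dsp n d. tilde_primed n matX Q = 0}"

definition Dpiece :: "nat \<Rightarrow> int \<Rightarrow> nat \<Rightarrow> ((nat \<Rightarrow> bit) \<Rightarrow> complex) set" where
  "Dpiece n d k = (tilde_primed n matY ^^ k) ` Dharm n (d - int k)"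

text \<open>Internal direct sums: the summation map from the product of the (finitely many) subspaces to
  \<open>W\<close> is bijective.\<close>

definition is_direct_sum :: "('a \<Rightarrow> complex) set \<Rightarrow> 'i set \<Rightarrow> ('i \<Rightarrow> ('a \<Rightarrow> complex) set) \<Rightarrow> bool" where
  "is_direct_sum W I U \<longleftrightarrow> finite I \<and> (\<forall>i\<in>I. cfun.subspace (U i)) \<and>
     bij_betw (\<lambda>u. \<Sum>i\<in>I. u i) (Pi\<^sub>E I U) W"

definition is_direct_sum2 ::
    "('a \<Rightarrow> complex) set \<Rightarrow> ('a \<Rightarrow> complex) set \<Rightarrow> ('a \<Rightarrow> complex) set \<Rightarrow> bool" where
  "is_direct_sum2 W A B \<longleftrightarrow> cfun.subspace A \<and> cfun.subspace B \<and>
     bij_betw (\<lambda>(a, b). a + b) (A \<times> B) W"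

text \<open>Binomial coefficients with integer lower index; they vanish when it is negative.\<close>

definition binom :: "nat \<Rightarrow> int \<Rightarrow> int" where
  "binom n k = (if k < 0 then 0 else int (n choose nat k))"

section \<open>Modules over \<open>sl\<^sub>2\<close>\<close>

definition sl2 :: "(complex^2^2) set" where
  "sl2 = {A. trace A = 0}"

definition complex_ring :: "complex ring" where
  "complex_ring = \<lparr>carrier = UNIV, mult = (*), one = 1, zero = 0, add = (+)\<rparr>"

locale sl2_module = Module.module complex_ring M
  for M :: "(complex, 'a, 'm) module_scheme" (structure) +
  fixes \<rho> :: "complex^2^2 \<Rightarrow> 'a \<Rightarrow> 'a"
  assumes act_closed: "A \<in> sl2 \<Longrightarrow> x \<in> carrier M \<Longrightarrow> \<rho> A x \<in> carrier M"
    and act_add: "A \<in> sl2 \<Longrightarrow> x \<in> carrier M \<Longrightarrow> y \<in> carrier M \<Longrightarrow>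
      \<rho> A (x \<oplus>\<^bsub>M\<^esub> y) = \<rho> A x \<oplus>\<^bsub>M\<^esub> \<rho> A y"
    and act_smult: "A \<in> sl2 \<Longrightarrow> x \<in> carrier M \<Longrightarrow> \<rho> A (c \<odot>\<^bsub>M\<^esub> x) = c \<odot>\<^bsub>M\<^esub> \<rho> A x"
    and add_act: "A \<in> sl2 \<Longrightarrow> B \<in> sl2 \<Longrightarrow> x \<in> carrier M \<Longrightarrow>
      \<rho> (A + B) x = \<rho> A x \<oplus>\<^bsub>M\<^esub> \<rho> B x"
    and smult_act: "A \<in> sl2 \<Longrightarrow> x \<in> carrier M \<Longrightarrow> \<rho> (mat c ** A) x = c \<odot>\<^bsub>M\<^esub> \<rho> A x"
    and bracket_act: "A \<in> sl2 \<Longrightarrow> B \<in> sl2 \<Longrightarrow> x \<in> carrier M \<Longrightarrow>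
      \<rho> (A ** B - B ** A) x = \<rho> A (\<rho> B x) \<ominus>\<^bsub>M\<^esub> \<rho> B (\<rho> A x)"

definition sl2_irreducible ::
    "(complex, 'a, 'm) module_scheme \<Rightarrow> (complex^2^2 \<Rightarrow> 'a \<Rightarrow> 'a) \<Rightarrow> bool" where
  "sl2_irreducible M \<rho> \<longleftrightarrow> sl2_module M \<rho> \<and> carrier M \<noteq> {\<zero>\<^bsub>M\<^esub>} \<and>
     (\<forall>N. submodule N complex_ring M \<and> (\<forall>A\<in>sl2. \<rho> A ` N \<subseteq> N) \<longrightarrow>
        N = {\<zero>\<^bsub>M\<^esub>} \<or> N = carrier M)"

definition sl2_isomorphic ::
    "(complex, 'a, 'm) module_scheme \<Rightarrow> (complex^2^2 \<Rightarrow> 'a \<Rightarrow> 'a) \<Rightarrow>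
     (complex, 'b, 'k) module_scheme \<Rightarrow> (complex^2^2 \<Rightarrow> 'b \<Rightarrow> 'b) \<Rightarrow> bool" where
  "sl2_isomorphic M \<rho> M' \<rho>' \<longleftrightarrow> sl2_module M \<rho> \<and> sl2_module M' \<rho>' \<and>
     (\<exists>\<phi>. bij_betw \<phi> (carrier M) (carrier M') \<and>
        (\<forall>x\<in>carrier M. \<forall>y\<in>carrier M. \<phi> (x \<oplus>\<^bsub>M\<^esub> y) = \<phi> x \<oplus>\<^bsub>M'\<^esub> \<phi> y) \<and>
        (\<forall>c. \<forall>x\<in>carrier M. \<phi> (c \<odot>\<^bsub>M\<^esub> x) = c \<odot>\<^bsub>M'\<^esub> \<phi> x) \<and>
        (\<forall>A\<in>sl2. \<forall>x\<in>carrier M. \<phi> (\<rho> A x) = \<rho>' A (\<phi> x)))"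

text \<open>The multiplicative fields of the record type \<open>module\<close> play no role for modules.\<close>

definition cfun_module :: "('a \<Rightarrow> complex) set \<Rightarrow> (complex, 'a \<Rightarrow> complex) module" where
  "cfun_module W = \<lparr>carrier = W, mult = undefined, one = undefined, zero = 0, add = (+),
     smult = (\<lambda>c f x. c * f x)\<rparr>"

definition quotient_module ::
    "(complex, 'a, 'm) module_scheme \<Rightarrow> 'a set \<Rightarrow> (complex, 'a set) module" where
  "quotient_module M N = \<lparr>carrier = a_rcosets\<^bsub>M\<^esub> N, mult = undefined, one = undefined, zero = N,
     add = set_add M, smult = (\<lambda>c S. \<Union>s\<in>S. N +>\<^bsub>M\<^esub> (c \<odot>\<^bsub>M\<^esub> s))\<rparr>"

definition quotient_action ::
    "(complex, 'a, 'm) module_scheme \<Rightarrow> 'a set \<Rightarrow> (complex^2^2 \<Rightarrow> 'a \<Rightarrow> 'a) \<Rightarrow>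
     complex^2^2 \<Rightarrow> 'a set \<Rightarrow> 'a set" where
  "quotient_action M N \<rho> A S = (\<Union>s\<in>S. N +>\<^bsub>M\<^esub> \<rho> A s)"

text \<open>\<open>Sym\<^sup>m(V\<^sub>1)\<close> is the quotient of the \<open>m\<close>-th tensor power of \<open>V\<^sub>1\<close> by the span of the differences
  of tensors that agree up to a permutation of the tensor factors, with the action induced from
  the standard action of \<open>sl\<^sub>2\<close> on \<open>V\<^sub>1\<close>.\<close>

definition sym_relations :: "nat \<Rightarrow> ((nat \<Rightarrow> bit) \<Rightarrow> complex) set" where
  "sym_relations m =
     cfun.span {f - (\<lambda>v. f (v \<circ> \<sigma>)) | f \<sigma>. f \<in> tensor_power m \<and> \<sigma> permutes {1..m}}"

definition sym_power :: "nat \<Rightarrow> (complex, ((nat \<Rightarrow> bit) \<Rightarrow> complex) set) module" where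
  "sym_power m = quotient_module (cfun_module (tensor_power m)) (sym_relations m)"

definition sym_action ::
    "nat \<Rightarrow> complex^2^2 \<Rightarrow> ((nat \<Rightarrow> bit) \<Rightarrow> complex) set \<Rightarrow> ((nat \<Rightarrow> bit) \<Rightarrow> complex) set" where
  "sym_action m = quotient_action (cfun_module (tensor_power m)) (sym_relations m) (tilde m)"

end

theory Submission
  imports Defs
begin

text \<open>
  In the basis of characters \<open>\<Prod>\<^sub>j\<^sub>\<in>\<^sub>J (-1)\<^bsup>v\<^sub>j\<^esup>\<close> the primed operators act like the standard \<open>sl\<^sub>2\<close>-triple
  on subsets: \<open>X'\<close> removes an element of \<open>J\<close> in all ways, \<open>Y'\<close> adds one, and \<open>H'\<close> multiplies by
  \<open>n - 2|J|\<close>. A harmonic \<open>Q\<close> of degree \<open>e\<close> is a highest weight vector of weight \<open>n - 2e\<close>, so that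
  \<open>X' Y'\<^sup>k\<^sup>+\<^sup>1 Q = (k + 1)(n - 2e - k) Y'\<^sup>k Q\<close>. By induction on \<open>d\<close>, \<open>X'Y'\<close> is diagonal with positive
  eigenvalues on \<open>\<D>\<^sub>d\<^sub>-\<^sub>1 = \<Oplus>\<^sub>k Y'\<^sup>k \<D>\<^sup>0\<^sub>d\<^sub>-\<^sub>1\<^sub>-\<^sub>k\<close>; subtracting \<open>Y' (X'Y')\<^sup>-\<^sup>1 X' f\<close> from \<open>f\<close> leaves a harmonic
  part, which gives the surjectivity, the decompositions and the dimensions.

  For the identification with \<open>Sym\<^sup>m(V\<^sub>1)\<close>, \<open>m = n - 2d\<close>, a tensor on \<open>{1..m}\<close> is mapped to the module
  generated by \<open>Q\<close> by summing its coefficients over positions of equal weight \<open>k\<close>, with value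
  \<open>(m - k)! Y'\<^sup>k Q\<close>. This map is equivariant and its kernel is spanned by the symmetry relations.
\<close>

section \<open>Scalar multiplication and linear maps on spaces of complex functions\<close>

definition scl :: "complex \<Rightarrow> ('a \<Rightarrow> complex) \<Rightarrow> 'a \<Rightarrow> complex" where
  "scl c f = (\<lambda>x. c * f x)"

lemma scl_apply: "scl c f x = c * f x"
  by (simp add: scl_def)

lemma scl_simps [simp]:
  "scl 0 f = 0" "scl 1 f = f" "scl c 0 = 0" "scl a (scl b f) = scl (a * b) f" "scl (- c) f = - scl c f"
  by (simp_all add: scl_def fun_eq_iff)

lemma scl_distribs:
  "scl c (f + g) = scl c f + scl c g" "scl c (f - g) = scl c f - scl c g"
  "scl (a + b) f = scl a f + scl b f" "scl (a - b) f = scl a f - scl b f"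
  by (simp_all add: scl_def fun_eq_iff algebra_simps)

lemma scl_eq_0_iff [simp]: "scl c f = 0 \<longleftrightarrow> c = 0 \<or> f = 0"
  by (auto simp add: scl_def fun_eq_iff)

lemma sum_fun_app: "(\<Sum>i\<in>I. F i) x = (\<Sum>i\<in>I. F i x)" for F :: "'i \<Rightarrow> 'a \<Rightarrow> complex"
  by (induction I rule: infinite_finite_induct) auto

lemma scl_sum: "scl c (\<Sum>i\<in>I. F i) = (\<Sum>i\<in>I. scl c (F i))"
  by (simp add: fun_eq_iff sum_fun_app scl_apply sum_distrib_left)

lemma sum_scl: "(\<Sum>i\<in>I. scl (c i) f) = scl (\<Sum>i\<in>I. c i) f"
  by (simp add: fun_eq_iff sum_fun_app scl_apply sum_distrib_right)

lemma sum_const_scl: "(\<Sum>i\<in>I. f) = scl (of_nat (card I)) f"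
  by (simp add: fun_eq_iff sum_fun_app scl_apply)

lemma subspace_iff:
  "cfun.subspace W \<longleftrightarrow> 0 \<in> W \<and> (\<forall>f\<in>W. \<forall>g\<in>W. f + g \<in> W) \<and> (\<forall>c. \<forall>f\<in>W. scl c f \<in> W)"
  by (simp add: cfun.subspace_def scl_def)

lemma subspace_scl: "cfun.subspace S \<Longrightarrow> f \<in> S \<Longrightarrow> scl c f \<in> S"
  by (simp add: subspace_iff)

text \<open>Two bare equations in terms of \<open>scl\<close>, so that linearity of a concrete
  operator is a simplifier goal; the link to the library notion follows.\<close>

definition clinear :: "(('a \<Rightarrow> complex) \<Rightarrow> 'b \<Rightarrow> complex) \<Rightarrow> bool" where
  "clinear F \<longleftrightarrow> (\<forall>f g. F (f + g) = F f + F g) \<and> (\<forall>c f. F (scl c f) = scl c (F f))"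

lemma clinear_iff_linear:
  "clinear F \<longleftrightarrow> Vector_Spaces.linear (\<lambda>c f x. c * f x) (\<lambda>c f x. c * f x) F"
  by (auto simp: clinear_def Vector_Spaces.linear_iff scl_def cfun.vector_space_axioms)

lemma
  assumes "clinear F"
  shows clinear_add: "F (f + g) = F f + F g"
    and clinear_scl: "F (scl c f) = scl c (F f)"
    and clinear_zero: "F 0 = 0"
    and clinear_diff: "F (f - g) = F f - F g"
    and clinear_sum: "F (\<Sum>i\<in>I. h i) = (\<Sum>i\<in>I. F (h i))"
proof -
  interpret Vector_Spaces.linear "\<lambda>c f x. c * f x" "\<lambda>c f x. c * f x" F
    using assms by (simp add: clinear_iff_linear)
  show "F (f + g) = F f + F g" "F 0 = 0" "F (f - g) = F f - F g"
    "F (\<Sum>i\<in>I. h i) = (\<Sum>i\<in>I. F (h i))"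
    by (rule add zero diff sum)+
  show "F (scl c f) = scl c (F f)"
    using assms by (simp add: clinear_def)
qed

lemma clinear_eq_on_span:
  assumes "clinear F" "clinear G" "\<And>f. f \<in> S \<Longrightarrow> F f = G f" "f \<in> cfun.span S"
  shows "F f = G f"
  using assms(4)
proof (induction rule: cfun.span_induct_alt)
  case base
  show ?case using assms by (metis clinear_zero)
next
  case (step c f g)
  then have "F (scl c f + g) = G (scl c f + g)" using assms(3)[OF step(1)]
    by (simp add: clinear_add[OF assms(1)] clinear_add[OF assms(2)]
        clinear_scl[OF assms(1)] clinear_scl[OF assms(2)])
  then show ?case by (simp only: scl_def)
qed

lemma clinear_image_span: "clinear F \<Longrightarrow> F ` cfun.span S = cfun.span (F ` S)"
  unfolding clinear_iff_linear
  by (simp add: module_hom.span_image module_hom_iff_linear)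

lemma clinear_scl_fun: "clinear (scl c)"
  by (simp add: clinear_def scl_distribs mult.commute)

lemma clinear_funpow: "clinear F \<Longrightarrow> clinear (F ^^ k)"
  for F :: "('a \<Rightarrow> complex) \<Rightarrow> 'a \<Rightarrow> complex"
  by (induction k) (simp_all add: clinear_def)

section \<open>Action of matrices on tensor powers\<close>

lemma slot_alt: "slot j M f v =
    M $ pos (v j) $ 1 * f (v(j := 0)) + M $ pos (v j) $ 2 * f (v(j := 1))"
  by (simp add: slot_def pos_def)

lemma clinear_slot: "clinear (slot j M)"
  by (auto simp: clinear_def slot_alt fun_eq_iff scl_apply algebra_simps)

lemma slot_add_matrix: "slot j (A + B) f = slot j A f + slot j B f"
  by (simp add: fun_eq_iff slot_alt algebra_simps)

lemma slot_diff_matrix: "slot j (A - B) f = slot j A f - slot j B f"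
  by (simp add: fun_eq_iff slot_alt algebra_simps)

lemma slot_mat_mult: "slot j (mat c ** A) f = scl c (slot j A f)"
proof -
  have "(mat c ** A) $ p $ q = c * A $ p $ q" for p q
    using exhaust_2[of p] by (auto simp: matrix_matrix_mult_def mat_def UNIV_2)
  then show ?thesis
    by (simp add: fun_eq_iff slot_alt scl_apply algebra_simps)
qed

lemma slot_slot_same: "slot j A (slot j B f) = slot j (A ** B) f"
  by (simp add: fun_eq_iff slot_alt matrix_matrix_mult_def UNIV_2 pos_def algebra_simps)

lemma slot_slot_commute: "i \<noteq> j \<Longrightarrow> slot i A (slot j B f) = slot j B (slot i A f)"
  by (simp add: fun_eq_iff slot_alt fun_upd_twist algebra_simps)

lemma clinear_tilde: "clinear (tilde n M)"
  using clinear_slot[of _ M]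
  by (simp add: clinear_def tilde_def sum.distrib scl_sum)

lemma tilde_add_matrix: "tilde n (A + B) f = tilde n A f + tilde n B f"
  by (simp add: tilde_def slot_add_matrix sum.distrib)

lemma tilde_mat_mult: "tilde n (mat c ** A) f = scl c (tilde n A f)"
  by (simp add: tilde_def slot_mat_mult scl_sum)

text \<open>Operators on different tensor factors commute, so only the diagonal of the double sum
  for the commutator survives, and there it is the commutator inside one factor.\<close>

lemma tilde_bracket: "tilde n (A ** B - B ** A) f = tilde n A (tilde n B f) - tilde n B (tilde n A f)"
proof -
  have *: "tilde n A (tilde n B f) = (\<Sum>i\<in>{1..n}. \<Sum>j\<in>{1..n}. slot i A (slot j B f))" for A B
    by (simp add: tilde_def clinear_sum[OF clinear_slot])
  \<comment> \<open>Swapping one of the two double sums pairs each product of slot operators with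
    the product of the same two operators in opposite order.\<close>
  have "tilde n A (tilde n B f) - tilde n B (tilde n A f) =
      (\<Sum>i\<in>{1..n}. \<Sum>j\<in>{1..n}. slot i A (slot j B f) - slot j B (slot i A f))"
    unfolding * by (subst (2) sum.swap) (simp add: sum_subtractf)
  also have "\<dots> = (\<Sum>i\<in>{1..n}. \<Sum>j\<in>{1..n}. if i = j then slot i (A ** B - B ** A) f else 0)"
    by (intro sum.cong refl) (auto simp: slot_slot_same slot_diff_matrix slot_slot_commute)
  also have "\<dots> = tilde n (A ** B - B ** A) f"
    by (simp add: tilde_def sum.delta)
  finally show ?thesis by simp
qed

section \<open>Conjugation by T\<close>

lemma matrix_inv_matT: "matrix_inv matT = vector [vector [1/2, 1/2], vector [1/2, -1/2]]" (is "_ = ?S")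
proof -
  have S: "matT ** ?S = mat 1" "?S ** matT = mat 1"
    by (simp_all add: vec_eq_iff forall_2 matrix_matrix_mult_def UNIV_2 matT_def mat_def)
  show ?thesis unfolding matrix_inv_def
  proof (rule some_equality)
    \<comment> \<open>\<open>matrix_inv\<close> is chosen among the two-sided inverses, and such an
      inverse is unique.\<close>
    fix A assume "matT ** A = mat 1 \<and> A ** matT = mat 1"
    then show "A = ?S" by (metis S(1) matrix_mul_assoc matrix_mul_lid matrix_mul_rid)
  qed (use S in blast)
qed

lemma matT_inverse: "matT ** matrix_inv matT = mat 1" "matrix_inv matT ** matT = mat 1"
  unfolding matrix_inv_matT
  by (simp_all add: vec_eq_iff forall_2 matrix_matrix_mult_def UNIV_2 matT_def mat_def)

lemma primed_add: "primed (A + B) = primed A + primed B"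
  by (simp add: primed_def vec_eq_iff matrix_matrix_mult_def UNIV_2 algebra_simps)

lemma primed_diff: "primed (A - B) = primed A - primed B"
  using primed_add[of "A - B" B] by simp

text \<open>T and its inverse cancel in the middle. Hence conjugation respects brackets, and the
  relations of \<open>tilde\<close> carry over to \<open>tilde_primed\<close>.\<close>

lemma primed_mult: "primed (A ** B) = primed A ** primed B"
  by (metis primed_def matT_inverse(1) matrix_mul_assoc matrix_mul_rid)

lemma primed_mat: "primed (mat c ** A) = mat c ** primed A"
proof -
  have "mat c ** M = M ** mat c" for M :: "complex^2^2"
    by (simp add: vec_eq_iff forall_2 matrix_matrix_mult_def UNIV_2 mat_def)
  then show ?thesis by (metis primed_def matrix_mul_assoc)
qed

lemma clinear_tilde_primed: "clinear (tilde_primed n M)"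
  by (simp add: tilde_primed_def clinear_tilde)

lemma tilde_primed_add: "tilde_primed n (A + B) f = tilde_primed n A f + tilde_primed n B f"
  by (simp add: tilde_primed_def primed_add tilde_add_matrix)

lemma tilde_primed_mat: "tilde_primed n (mat c ** A) f = scl c (tilde_primed n A f)"
  by (simp add: tilde_primed_def primed_mat tilde_mat_mult)

lemma tilde_primed_bracket: "tilde_primed n (A ** B - B ** A) f =
    tilde_primed n A (tilde_primed n B f) - tilde_primed n B (tilde_primed n A f)"
  by (simp add: tilde_primed_def primed_diff primed_mult tilde_bracket)

text \<open>Used with two bases of the plane: (1, 1), (1, -1) gives the monomials on which the
  primed operators act simply, and the standard basis gives the basis tensors needed for the
  symmetric power.\<close>

definition ptens :: "nat \<Rightarrow> complex^2 \<Rightarrow> complex^2 \<Rightarrow> nat set \<Rightarrow> (nat \<Rightarrow> bit) \<Rightarrow> complex" where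
  "ptens n a b J = pure_tensor n (\<lambda>j. if j \<in> J then b else a)"

lemma pure_tensor_lincomb:
  assumes "j \<in> {1..n}"
  shows "pure_tensor n (g(j := x *s a + y *s b)) =
    scl x (pure_tensor n (g(j := a))) + scl y (pure_tensor n (g(j := b)))"
  using assms
  by (auto simp: fun_eq_iff pure_tensor_def scl_apply prod.remove[of _ j] algebra_simps)

text \<open>A pure tensor is linear in factor j, so applying M there expands into the tensors with a
  or b in that position.\<close>

lemma slot_ptens:
  assumes "j \<in> {1..n}" "M *v a = p *s a + q *s b" "M *v b = r *s a + s *s b"
  shows "slot j M (ptens n a b J) = (if j \<in> J
     then scl r (ptens n a b (J - {j})) + scl s (ptens n a b J)
     else scl p (ptens n a b J) + scl q (ptens n a b (insert j J)))"
proof -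
  define g where "g J = (\<lambda>j. if j \<in> J then b else a)" for J :: "nat set"
  have g: "(g J)(j := b) = g (insert j J)" "(g J)(j := a) = g (J - {j})"
    by (auto simp: g_def)
  have "slot j M (ptens n a b J) = pure_tensor n ((g J)(j := M *v g J j))"
    using assms(1) by (simp add: ptens_def slot_pure_tensor g_def)
  also have "\<dots> = (if j \<in> J
     then scl r (pure_tensor n (g (J - {j}))) + scl s (pure_tensor n (g (insert j J)))
     else scl p (pure_tensor n (g (J - {j}))) + scl q (pure_tensor n (g (insert j J))))"
    using assms(2,3) by (cases "j \<in> J") (simp_all add: pure_tensor_lincomb[OF assms(1)] g g_def[of J, THEN fun_cong, of j])
  finally show ?thesis by (simp add: ptens_def g_def insert_absorb)
qed

lemma tilde_ptens:
  assumes "J \<subseteq> {1..n}" "M *v a = p *s a + q *s b" "M *v b = r *s a + s *s b"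
  shows "tilde n M (ptens n a b J) =
     scl (of_nat (n - card J) * p + of_nat (card J) * s) (ptens n a b J) +
     scl q (\<Sum>j\<in>{1..n}-J. ptens n a b (insert j J)) + scl r (\<Sum>j\<in>J. ptens n a b (J - {j}))"
proof -
  have fin: "finite J" using assms(1) finite_subset by blast
  have "tilde n M (ptens n a b J) = (\<Sum>j\<in>{1..n}-J. slot j M (ptens n a b J)) + (\<Sum>j\<in>J. slot j M (ptens n a b J))"
    unfolding tilde_def using assms(1) by (simp add: sum.subset_diff)
  also have "(\<Sum>j\<in>{1..n}-J. slot j M (ptens n a b J)) =
     (\<Sum>j\<in>{1..n}-J. scl p (ptens n a b J) + scl q (ptens n a b (insert j J)))"
    by (intro sum.cong refl) (use slot_ptens[OF _ assms(2,3)] in auto)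
  also have "(\<Sum>j\<in>J. slot j M (ptens n a b J)) =
     (\<Sum>j\<in>J. scl r (ptens n a b (J - {j})) + scl s (ptens n a b J))"
    by (intro sum.cong refl) (use slot_ptens[OF _ assms(2,3)] assms(1) in auto)
  finally show ?thesis
    using assms(1) fin
    by (simp only: sum.distrib sum_const_scl scl_sum[symmetric] scl_distribs card_Diff_subset scl_simps
        card_atLeastAtMost diff_Suc_1 add_ac Suc_eq_plus1 diff_add_inverse)
qed

section \<open>Characters and the grading\<close>

definition vec_one :: "complex^2" where "vec_one = vector [1, 1]"
definition vec_sign :: "complex^2" where "vec_sign = vector [1, -1]"

text \<open>As columns, the constant function 1 is (1, 1) and the sign character of one coordinate
  is (1, -1).\<close>

lemma monomial_eq_ptens:
  assumes "J \<subseteq> {1..n}"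
  shows "monomial_fun n J = ptens n vec_one vec_sign J"
proof
  fix v
  have "(\<Prod>j\<in>{1..n}. (if j \<in> J then vec_sign else vec_one) $ pos (v j)) =
      (\<Prod>j\<in>J. (-1) ^ (if v j = 0 then 0 else 1))"
    using assms
    by (intro prod.mono_neutral_cong_right) (auto simp: vec_one_def vec_sign_def pos_def)
  then show "monomial_fun n J v = ptens n vec_one vec_sign J v"
    by (simp add: monomial_fun_def ptens_def pure_tensor_def)
qed

text \<open>The two vectors are twice the columns of the inverse of T, so in this basis
  \<open>primed M\<close> has the matrix M.\<close>

lemma primed_mult_vec_one: "primed M *v vec_one = M $ 1 $ 1 *s vec_one + M $ 2 $ 1 *s vec_sign"
  and primed_mult_vec_sign: "primed M *v vec_sign = M $ 1 $ 2 *s vec_one + M $ 2 $ 2 *s vec_sign"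
  unfolding primed_def matrix_inv_matT
  by (simp_all add: vec_eq_iff forall_2 matrix_vector_mult_def
      matrix_matrix_mult_def UNIV_2 matT_def vec_one_def vec_sign_def field_simps)

lemma tilde_primed_monomial:
  assumes "J \<subseteq> {1..n}"
  shows "tilde_primed n M (monomial_fun n J) =
     scl (of_nat (n - card J) * M $ 1 $ 1 + of_nat (card J) * M $ 2 $ 2) (monomial_fun n J) +
     scl (M $ 2 $ 1) (\<Sum>j\<in>{1..n}-J. monomial_fun n (insert j J)) +
     scl (M $ 1 $ 2) (\<Sum>j\<in>J. monomial_fun n (J - {j}))"
proof -
  have "(\<Sum>j\<in>{1..n}-J. monomial_fun n (insert j J)) = (\<Sum>j\<in>{1..n}-J. ptens n vec_one vec_sign (insert j J))"
    "(\<Sum>j\<in>J. monomial_fun n (J - {j})) = (\<Sum>j\<in>J. ptens n vec_one vec_sign (J - {j}))"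
    using assms by (intro sum.cong monomial_eq_ptens; auto)+
  then show ?thesis
    using tilde_ptens[OF assms primed_mult_vec_one primed_mult_vec_sign] assms
    by (simp add: tilde_primed_def monomial_eq_ptens)
qed

lemma subspace_Dsp: "cfun.subspace (Dsp n e)"
  by (simp add: Dsp_def)

lemma monomial_in_Dsp: "J \<subseteq> {1..n} \<Longrightarrow> int (card J) = e \<Longrightarrow> monomial_fun n J \<in> Dsp n e"
  unfolding Dsp_def by (rule cfun.span_base) blast

lemma Dsp_image_subset:
  assumes "clinear F" "cfun.subspace S"
    and "\<And>J. J \<subseteq> {1..n} \<Longrightarrow> int (card J) = e \<Longrightarrow> F (monomial_fun n J) \<in> S"
    and "f \<in> Dsp n e"
  shows "F f \<in> S"
proof -
  have "F ` Dsp n e \<subseteq> S"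
    unfolding Dsp_def clinear_image_span[OF assms(1)]
    by (rule cfun.span_minimal) (use assms in auto)
  then show ?thesis using assms(4) by blast
qed

lemma Dsp_X:
  assumes "f \<in> Dsp n e"
  shows "tilde_primed n matX f \<in> Dsp n (e - 1)"
proof (rule Dsp_image_subset[OF clinear_tilde_primed subspace_Dsp _ assms])
  fix J assume J: "J \<subseteq> {1..n}" "int (card J) = e"
  then have fin: "finite J" using finite_subset by blast
  have "tilde_primed n matX (monomial_fun n J) = (\<Sum>j\<in>J. monomial_fun n (J - {j}))"
    using tilde_primed_monomial[OF J(1), of matX] by (simp add: matX_def)
  \<comment> \<open>Each J occurring with some j in it is nonempty, so the natural number
    \<open>card J - 1\<close> agrees with the integer e - 1.\<close>
  also have "\<dots> \<in> Dsp n (e - 1)"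
    by (rule cfun.subspace_sum[OF subspace_Dsp], rule monomial_in_Dsp)
      (use J fin card_gt_0_iff[of J] in \<open>auto simp: card_Diff_singleton\<close>)
  finally show "tilde_primed n matX (monomial_fun n J) \<in> Dsp n (e - 1)" .
qed

lemma Dsp_Y:
  assumes "f \<in> Dsp n e"
  shows "tilde_primed n matY f \<in> Dsp n (e + 1)"
proof (rule Dsp_image_subset[OF clinear_tilde_primed subspace_Dsp _ assms])
  fix J assume J: "J \<subseteq> {1..n}" "int (card J) = e"
  then have fin: "finite J" using finite_subset by blast
  have "tilde_primed n matY (monomial_fun n J) = (\<Sum>j\<in>{1..n}-J. monomial_fun n (insert j J))"
    using tilde_primed_monomial[OF J(1), of matY] by (simp add: matY_def)
  also have "\<dots> \<in> Dsp n (e + 1)"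
    by (rule cfun.subspace_sum[OF subspace_Dsp], rule monomial_in_Dsp) (use J fin in auto)
  finally show "tilde_primed n matY (monomial_fun n J) \<in> Dsp n (e + 1)" .
qed

text \<open>Each position outside J contributes weight 1 and each position in J weight -1.\<close>

lemma Dsp_H:
  assumes "f \<in> Dsp n e"
  shows "tilde_primed n matH f = scl (of_nat n - 2 * of_int e) f"
proof (rule clinear_eq_on_span[OF clinear_tilde_primed clinear_scl_fun _ assms[unfolded Dsp_def]])
  fix f assume "f \<in> {monomial_fun n J |J. J \<subseteq> {1..n} \<and> int (card J) = e}"
  then obtain J where J: "f = monomial_fun n J" "J \<subseteq> {1..n}" "int (card J) = e" by blast
  have "card J \<le> n" using card_mono[OF _ J(2)] by simp
  then have "complex_of_nat (n - card J) - of_nat (card J) = of_nat n - 2 * of_int e"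
    using J(3) by (simp add: of_nat_diff flip: J(3))
  then show "tilde_primed n matH f = scl (of_nat n - 2 * of_int e) f"
    using tilde_primed_monomial[OF J(2), of matH] by (simp add: matH_def J(1))
qed

text \<open>No subset has such a size. The lower bound starts the inductions on the degree; the
  upper bound makes Y' nilpotent.\<close>

lemma Dsp_trivial:
  assumes "e < 0 \<or> e > int n"
  shows "Dsp n e = {0}"
proof -
  have "int (card J) \<noteq> e" if "J \<subseteq> {1..n}" for J
    using assms card_mono[OF _ that] by auto
  then have "{monomial_fun n J |J. J \<subseteq> {1..n} \<and> int (card J) = e} = {}" by blast
  then show ?thesis by (simp only: Dsp_def cfun.span_empty)
qed

lemma Dsp_Y_pow: "f \<in> Dsp n e \<Longrightarrow> (tilde_primed n matY ^^ k) f \<in> Dsp n (e + int k)"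
proof (induction k)
  case (Suc k)
  then show ?case using Dsp_Y[of "(tilde_primed n matY ^^ k) f" n "e + int k"]
    by (simp add: ac_simps)
qed simp

section \<open>Highest weight vectors\<close>

lemma matrix_brackets:
  "matX ** matY - matY ** matX = matH"
  "matH ** matY - matY ** matH = mat (-2) ** matY"
  by (simp_all add: vec_eq_iff forall_2 matrix_matrix_mult_def UNIV_2 mat_def matX_def matY_def matH_def)

lemma X_Y: "tilde_primed n matX (tilde_primed n matY f) =
    tilde_primed n matY (tilde_primed n matX f) + tilde_primed n matH f"
  using tilde_primed_bracket[of n matX matY f] by (simp add: matrix_brackets)

lemma H_Y: "tilde_primed n matH (tilde_primed n matY f) =
    tilde_primed n matY (tilde_primed n matH f) + scl (-2) (tilde_primed n matY f)"
  using tilde_primed_bracket[of n matH matY f] by (simp only: matrix_brackets tilde_primed_mat)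
    (simp add: algebra_simps)

lemma H_Y_pow:
  assumes "tilde_primed n matH v = scl w v"
  shows "tilde_primed n matH ((tilde_primed n matY ^^ k) v) =
    scl (w - 2 * of_nat k) ((tilde_primed n matY ^^ k) v)"
proof (induction k)
  case 0
  then show ?case using assms by simp
next
  case (Suc k)
  let ?y = "(tilde_primed n matY ^^ k) v"
  have "tilde_primed n matH ((tilde_primed n matY ^^ Suc k) v) =
    tilde_primed n matY (scl (w - 2 * of_nat k) ?y) + scl (-2) (tilde_primed n matY ?y)"
    by (simp only: funpow.simps o_apply H_Y Suc.IH)
  also have "\<dots> = scl (w - 2 * of_nat (Suc k)) (tilde_primed n matY ?y)"
    by (simp only: clinear_scl[OF clinear_tilde_primed] flip: scl_distribs) (simp add: algebra_simps)
  finally show ?case by simp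
qed

text \<open>Moving X' past one Y' leaves H', which has eigenvalue w - 2i on Y'^i v; the sum of these
  for i = 0, ..., k is (k + 1)(w - k).\<close>

lemma X_Y_pow:
  assumes "tilde_primed n matX v = 0" "tilde_primed n matH v = scl w v"
  shows "tilde_primed n matX ((tilde_primed n matY ^^ Suc k) v) =
    scl (of_nat (Suc k) * (w - of_nat k)) ((tilde_primed n matY ^^ k) v)"
proof (induction k)
  case 0
  then show ?case
    using assms by (simp add: X_Y clinear_zero[OF clinear_tilde_primed])
next
  case (Suc k)
  let ?y = "(tilde_primed n matY ^^ Suc k) v"
  have "tilde_primed n matX ((tilde_primed n matY ^^ Suc (Suc k)) v) =
      tilde_primed n matY (scl (of_nat (Suc k) * (w - of_nat k)) ((tilde_primed n matY ^^ k) v)) +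
      scl (w - 2 * of_nat (Suc k)) ?y"
    using X_Y[of n ?y] by (simp only: funpow.simps(2)[of "Suc k"] o_apply H_Y_pow[OF assms(2)] Suc.IH)
  also have "\<dots> = scl (of_nat (Suc (Suc k)) * (w - of_nat (Suc k))) ?y"
    by (simp only: clinear_scl[OF clinear_tilde_primed] funpow.simps o_apply flip: scl_distribs)
      (simp add: algebra_simps)
  finally show ?case .
qed

section \<open>Decomposition into harmonic parts\<close>

lemma Dharm_weight:
  assumes "Q \<in> Dharm n e"
  shows "tilde_primed n matX Q = 0" "tilde_primed n matH Q = scl (of_nat n - 2 * of_int e) Q"
    "Q \<in> Dsp n e"
  using assms Dsp_H by (auto simp: Dharm_def)

lemma subspace_Dharm: "cfun.subspace (Dharm n e)"
  using subspace_Dsp[of n e]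
  by (auto simp: subspace_iff Dharm_def clinear_zero[OF clinear_tilde_primed]
      clinear_add[OF clinear_tilde_primed] clinear_scl[OF clinear_tilde_primed])

text \<open>X'Y' is diagonal on the pieces: Q k has degree e - k, hence weight n - 2e + 2k, and
  subtracting k gives the second factor of the eigenvalue. The eigenvalue is placed on Q k so that
  the result is again a sum of powers of Y' applied to harmonic polynomials.\<close>

lemma X_Y_sum_harmonic:
  assumes "\<And>k. k \<le> e \<Longrightarrow> Q k \<in> Dharm n (int e - int k)"
  shows "tilde_primed n matX (\<Sum>k\<le>e. (tilde_primed n matY ^^ Suc k) (Q k)) =
    (\<Sum>k\<le>e. (tilde_primed n matY ^^ k)
       (scl (of_int (int (Suc k) * (int n - 2 * int e + int k))) (Q k)))"
  unfolding clinear_sum[OF clinear_tilde_primed]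
proof (rule sum.cong[OF refl])
  fix k assume "k \<in> {..e}"
  then have "Q k \<in> Dharm n (int e - int k)" using assms by simp
  note X_Y_pow[OF Dharm_weight(1,2)[OF this], of k]
  moreover have "complex_of_nat (Suc k) * (of_nat n - 2 * of_int (int e - int k) - of_nat k) =
     of_int (int (Suc k) * (int n - 2 * int e + int k))"
    by (simp add: algebra_simps)
  ultimately show "tilde_primed n matX ((tilde_primed n matY ^^ Suc k) (Q k)) = (tilde_primed n matY ^^ k)
       (scl (of_int (int (Suc k) * (int n - 2 * int e + int k))) (Q k))"
    by (simp only: clinear_scl[OF clinear_funpow[OF clinear_tilde_primed]])
qed

text \<open>Both factors are positive strictly below the middle degree; the cast from the integers
  lets this be decided by integer arithmetic.\<close>

lemma X_Y_coeff_nonzero: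
  assumes "2 * e < n"
  shows "complex_of_int (int (Suc k) * (int n - 2 * int e + int k)) \<noteq> 0"
  unfolding of_int_eq_0_iff using assms by simp

text \<open>Induction on the degree: decompose X' f, divide each piece by its eigenvalue under X'Y'
  and apply Y'. The result g satisfies X' g = X' f, so f - g is harmonic and becomes the piece for k
  = 0.\<close>

lemma harmonic_decomposition:
  assumes "2 * e \<le> n" "f \<in> Dsp n (int e)"
  shows "\<exists>Q. (\<forall>k\<le>e. Q k \<in> Dharm n (int e - int k)) \<and> f = (\<Sum>k\<le>e. (tilde_primed n matY ^^ k) (Q k))"
  using assms
proof (induction e arbitrary: f)
  case 0
  \<comment> \<open>In degree 0 everything is harmonic, since X' maps into degree -1.\<close>
  have "tilde_primed n matX f = 0"
    using Dsp_X[OF 0(2)] Dsp_trivial[of "-1" n] by simp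
  then have "f \<in> Dharm n 0" using 0 by (simp add: Dharm_def)
  then show ?case by (intro exI[of _ "\<lambda>_. f"]) simp
next
  case (Suc e)
  have "tilde_primed n matX f \<in> Dsp n (int e)" using Dsp_X[OF Suc.prems(2)] by simp
  then obtain R where R: "\<And>k. k \<le> e \<Longrightarrow> R k \<in> Dharm n (int e - int k)"
    and Xf: "tilde_primed n matX f = (\<Sum>k\<le>e. (tilde_primed n matY ^^ k) (R k))"
    using Suc.IH[of "tilde_primed n matX f"] Suc.prems by auto
  \<comment> \<open>The eigenvalues of X'Y' in degree e, which lies strictly below the middle
    because 2(e + 1) is at most n.\<close>
  define c where "c k = complex_of_int (int (Suc k) * (int n - 2 * int e + int k))" for k
  have c: "c k \<noteq> 0" for k
    unfolding c_def by (rule X_Y_coeff_nonzero) (use Suc.prems in simp)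
  define S where "S k = scl (1 / c k) (R k)" for k
  have S: "S k \<in> Dharm n (int e - int k)" if "k \<le> e" for k
    unfolding S_def by (rule subspace_scl[OF subspace_Dharm R[OF that]])
  define g where "g = (\<Sum>k\<le>e. (tilde_primed n matY ^^ Suc k) (S k))"
  have "tilde_primed n matX g = (\<Sum>k\<le>e. (tilde_primed n matY ^^ k) (scl (c k) (S k)))"
    unfolding g_def c_def by (rule X_Y_sum_harmonic) (rule S)
  then have "tilde_primed n matX g = tilde_primed n matX f"
    by (simp add: S_def c Xf)
  moreover have "g \<in> Dsp n (int (Suc e))"
    unfolding g_def
  proof (rule cfun.subspace_sum[OF subspace_Dsp])
    fix k assume "k \<in> {..e}"
    then show "(tilde_primed n matY ^^ Suc k) (S k) \<in> Dsp n (int (Suc e))"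
      using Dsp_Y_pow[OF Dharm_weight(3)[OF S[of k]], of "Suc k"] by (simp add: ac_simps)
  qed
  ultimately have h: "f - g \<in> Dharm n (int (Suc e))"
    using Suc.prems cfun.subspace_diff[OF subspace_Dsp]
    by (simp add: Dharm_def clinear_diff[OF clinear_tilde_primed])
  \<comment> \<open>The pieces of g carry one more factor Y' than those of X' f, so their indices
    shift by one and index 0 is free for f - g.\<close>
  define Q where "Q = case_nat (f - g) S"
  have "f = (f - g) + g" by simp
  also have "\<dots> = (\<Sum>k\<le>Suc e. (tilde_primed n matY ^^ k) (Q k))"
    unfolding sum.atMost_Suc_shift g_def Q_def by simp
  finally have "f = (\<Sum>k\<le>Suc e. (tilde_primed n matY ^^ k) (Q k))" .
  moreover have "\<forall>k\<le>Suc e. Q k \<in> Dharm n (int (Suc e) - int k)"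
    using h S by (auto simp: Q_def split: nat.split)
  ultimately show ?case by blast
qed

text \<open>X' kills the term for k = 0 and turns the rest into a vanishing sum one degree lower
  with nonzero factors. By induction all terms with k > 0 vanish, and then so does the
  first.\<close>

lemma harmonic_decomposition_unique:
  assumes "2 * e \<le> n" "\<And>k. k \<le> e \<Longrightarrow> Q k \<in> Dharm n (int e - int k)"
    and "(\<Sum>k\<le>e. (tilde_primed n matY ^^ k) (Q k)) = 0" and "k \<le> e"
  shows "Q k = 0"
  using assms
proof (induction e arbitrary: Q k)
  case 0
  then show ?case by simp
next
  case (Suc e)
  define c where "c k = complex_of_int (int (Suc k) * (int n - 2 * int e + int k))" for k
  have c: "c k \<noteq> 0" for k
    unfolding c_def by (rule X_Y_coeff_nonzero) (use Suc.prems in simp)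
  have Q: "Q (Suc k) \<in> Dharm n (int e - int k)" if "k \<le> e" for k
    using Suc.prems(2)[of "Suc k"] that by simp
  have Q0: "Q 0 \<in> Dharm n (int (Suc e))" using Suc.prems(2)[of 0] by simp
  have split: "Q 0 + (\<Sum>k\<le>e. (tilde_primed n matY ^^ Suc k) (Q (Suc k))) = 0"
    using Suc.prems(3) unfolding sum.atMost_Suc_shift funpow_0 .
  then have "tilde_primed n matX (Q 0 + (\<Sum>k\<le>e. (tilde_primed n matY ^^ Suc k) (Q (Suc k)))) = 0"
    by (simp only: clinear_zero[OF clinear_tilde_primed])
  then have "tilde_primed n matX (\<Sum>k\<le>e. (tilde_primed n matY ^^ Suc k) (Q (Suc k))) = 0"
    unfolding clinear_add[OF clinear_tilde_primed] Dharm_weight(1)[OF Q0] add_0 .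
  moreover have "tilde_primed n matX (\<Sum>k\<le>e. (tilde_primed n matY ^^ Suc k) (Q (Suc k))) =
      (\<Sum>k\<le>e. (tilde_primed n matY ^^ k) (scl (c k) (Q (Suc k))))"
    unfolding c_def by (rule X_Y_sum_harmonic) (rule Q)
  ultimately have "(\<Sum>k\<le>e. (tilde_primed n matY ^^ k) (scl (c k) (Q (Suc k)))) = 0" by (rule subst[rotated])
  then have "scl (c k) (Q (Suc k)) = 0" if "k \<le> e" for k
    by (intro Suc.IH[of "\<lambda>k. scl (c k) (Q (Suc k))"] subspace_scl[OF subspace_Dharm] Q that)
      (use Suc.prems(1) in simp)
  then have *: "Q (Suc k) = 0" if "k \<le> e" for k using c that by simp
  then have "Q 0 = 0"
    using split by (simp add: clinear_zero[OF clinear_tilde_primed] clinear_zero[OF clinear_funpow[OF clinear_tilde_primed]])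
  then show ?case using * Suc.prems(4) by (cases k) auto
qed

section \<open>Invertibility of X'Y' below the middle degree\<close>

lemma X_Y_surj:
  assumes "2 * e < int n" "f \<in> Dsp n e"
  obtains g where "g \<in> Dsp n e" "tilde_primed n matX (tilde_primed n matY g) = f"
proof (cases "e < 0")
  case True
  then have "f = 0" using assms Dsp_trivial by auto
  then have "f \<in> Dsp n e" "tilde_primed n matX (tilde_primed n matY f) = f"
    using assms by (simp_all add: clinear_zero[OF clinear_tilde_primed])
  then show ?thesis using that by blast
next
  case False
  define m where "m = nat e"
  have m: "e = int m" "2 * m < n" using False assms by (auto simp: m_def)
  obtain R where R: "\<And>k. k \<le> m \<Longrightarrow> R k \<in> Dharm n (int m - int k)"
    and f: "f = (\<Sum>k\<le>m. (tilde_primed n matY ^^ k) (R k))"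
    using harmonic_decomposition[of m n f] m assms(2) by auto
  define c where "c k = complex_of_int (int (Suc k) * (int n - 2 * int m + int k))" for k
  have c: "c k \<noteq> 0" for k
    unfolding c_def by (rule X_Y_coeff_nonzero) (use m in simp)
  define S where "S k = scl (1 / c k) (R k)" for k
  have S: "S k \<in> Dharm n (int m - int k)" if "k \<le> m" for k
    unfolding S_def by (rule subspace_scl[OF subspace_Dharm R[OF that]])
  define g where "g = (\<Sum>k\<le>m. (tilde_primed n matY ^^ k) (S k))"
  have "tilde_primed n matX (tilde_primed n matY g) =
      tilde_primed n matX (\<Sum>k\<le>m. (tilde_primed n matY ^^ Suc k) (S k))"
    by (simp add: g_def clinear_sum[OF clinear_tilde_primed])
  also have "\<dots> = (\<Sum>k\<le>m. (tilde_primed n matY ^^ k) (scl (c k) (S k)))"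
    unfolding c_def by (rule X_Y_sum_harmonic) (rule S)
  also have "\<dots> = f"
    by (simp add: S_def c f)
  finally have "tilde_primed n matX (tilde_primed n matY g) = f" .
  moreover have "g \<in> Dsp n e"
    unfolding g_def m
  proof (rule cfun.subspace_sum[OF subspace_Dsp])
    fix k assume "k \<in> {..m}"
    then show "(tilde_primed n matY ^^ k) (S k) \<in> Dsp n (int m)"
      using Dsp_Y_pow[OF Dharm_weight(3)[OF S[of k]], of k] by simp
  qed
  ultimately show ?thesis using that by blast
qed

text \<open>In the diagonal form of X'Y', uniqueness of the decomposition makes every scaled piece
  vanish, and the scalars are nonzero.\<close>

lemma X_Y_inj:
  assumes "2 * e < int n" "g \<in> Dsp n e" "tilde_primed n matX (tilde_primed n matY g) = 0"
  shows "g = 0"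
proof (cases "e < 0")
  case True
  then show ?thesis using assms Dsp_trivial by auto
next
  case False
  define m where "m = nat e"
  have m: "e = int m" "2 * m < n" using False assms by (auto simp: m_def)
  obtain R where R: "\<And>k. k \<le> m \<Longrightarrow> R k \<in> Dharm n (int m - int k)"
    and g: "g = (\<Sum>k\<le>m. (tilde_primed n matY ^^ k) (R k))"
    using harmonic_decomposition[of m n g] m assms(2) by auto
  define c where "c k = complex_of_int (int (Suc k) * (int n - 2 * int m + int k))" for k
  have c: "c k \<noteq> 0" for k
    unfolding c_def by (rule X_Y_coeff_nonzero) (use m in simp)
  have "tilde_primed n matX (\<Sum>k\<le>m. (tilde_primed n matY ^^ Suc k) (R k)) = 0"
    using assms(3) by (simp add: g clinear_sum[OF clinear_tilde_primed])
  moreover have "tilde_primed n matX (\<Sum>k\<le>m. (tilde_primed n matY ^^ Suc k) (R k)) =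
      (\<Sum>k\<le>m. (tilde_primed n matY ^^ k) (scl (c k) (R k)))"
    unfolding c_def by (rule X_Y_sum_harmonic) (rule R)
  ultimately have "(\<Sum>k\<le>m. (tilde_primed n matY ^^ k) (scl (c k) (R k))) = 0" by (rule subst[rotated])
  then have "scl (c k) (R k) = 0" if "k \<le> m" for k
    using harmonic_decomposition_unique[of m n "\<lambda>k. scl (c k) (R k)" k] m(2) that
      subspace_scl[OF subspace_Dharm R] by simp
  then show ?thesis
    using c by (simp add: g clinear_zero[OF clinear_funpow[OF clinear_tilde_primed]])
qed

text \<open>Degree e - 1 is strictly below the middle, so solving X'Y' g = f there gives the
  preimage Y' g.\<close>

lemma X_image_Dsp:
  assumes "2 * e \<le> int n"
  shows "tilde_primed n matX ` Dsp n e = Dsp n (e - 1)"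
proof
  show "tilde_primed n matX ` Dsp n e \<subseteq> Dsp n (e - 1)"
    using Dsp_X by blast
next
  show "Dsp n (e - 1) \<subseteq> tilde_primed n matX ` Dsp n e"
  proof
    fix f assume "f \<in> Dsp n (e - 1)"
    then obtain g where "g \<in> Dsp n (e - 1)" "tilde_primed n matX (tilde_primed n matY g) = f"
      using X_Y_surj[of "e - 1" n f] assms by auto
    moreover from this(1) have "tilde_primed n matY g \<in> Dsp n e"
      using Dsp_Y[of g n "e - 1"] by simp
    ultimately show "f \<in> tilde_primed n matX ` Dsp n e" by blast
  qed
qed

section \<open>Direct sum decompositions\<close>

lemma subspace_clinear_image:
  assumes "clinear F" "cfun.subspace S"
  shows "cfun.subspace (F ` S)"
proof -
  have "F ` S = cfun.span (F ` S)"
    using assms(2) clinear_image_span[OF assms(1), of S] by (metis cfun.span_eq_iff)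
  then show ?thesis
    by (metis cfun.subspace_span)
qed

text \<open>Injectivity of X'Y' in degree e - 1 separates the two summands; its surjectivity
  supplies the correction that makes f harmonic.\<close>

lemma direct_sum_harmonic_Y:
  assumes "2 * e \<le> int n"
  shows "is_direct_sum2 (Dsp n e) (Dharm n e) (tilde_primed n matY ` Dsp n (e - 1))"
  unfolding is_direct_sum2_def
proof (intro conjI subspace_Dharm subspace_clinear_image clinear_tilde_primed subspace_Dsp)
  let ?X = "tilde_primed n matX" and ?Y = "tilde_primed n matY"
  have Y: "?Y g \<in> Dsp n e" if "g \<in> Dsp n (e - 1)" for g
    using Dsp_Y[OF that] by simp
  show "bij_betw (\<lambda>(a, b). a + b) (Dharm n e \<times> ?Y ` Dsp n (e - 1)) (Dsp n e)"
  proof (rule bij_betw_imageI)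
    show "inj_on (\<lambda>(a, b). a + b) (Dharm n e \<times> ?Y ` Dsp n (e - 1))"
    proof (rule inj_onI, clarsimp)
      fix a a' g g'
      assume a: "a \<in> Dharm n e" "a' \<in> Dharm n e" and g: "g \<in> Dsp n (e - 1)" "g' \<in> Dsp n (e - 1)"
        and eq: "a + ?Y g = a' + ?Y g'"
      have "?X (a + ?Y g) = ?X (a' + ?Y g')" using eq by (rule arg_cong)
      then have "?X (?Y (g - g')) = 0"
        using Dharm_weight(1)[OF a(1)] Dharm_weight(1)[OF a(2)]
        by (simp only: clinear_add[OF clinear_tilde_primed] clinear_diff[OF clinear_tilde_primed] add_0 diff_self)
      then have "g - g' = 0"
        using X_Y_inj[of "e - 1" n "g - g'"] cfun.subspace_diff[OF subspace_Dsp g] assms by auto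
      then have "g = g'" by simp
      then show "a = a' \<and> ?Y g = ?Y g'" using eq by simp
    qed
  next
    show "(\<lambda>(a, b). a + b) ` (Dharm n e \<times> ?Y ` Dsp n (e - 1)) = Dsp n e"
    proof (intro equalityI subsetI)
      fix f assume "f \<in> (\<lambda>(a, b). a + b) ` (Dharm n e \<times> ?Y ` Dsp n (e - 1))"
      then show "f \<in> Dsp n e"
        using cfun.subspace_add[OF subspace_Dsp] Y Dharm_weight(3) by auto
    next
      fix f assume f: "f \<in> Dsp n e"
      \<comment> \<open>Y' g has the same image under X' as f, so f - Y' g is harmonic.\<close>
      obtain g where g: "g \<in> Dsp n (e - 1)" "?X (?Y g) = ?X f"
        using X_Y_surj[of "e - 1" n "?X f"] assms Dsp_X[OF f] by auto
      have "f - ?Y g \<in> Dharm n e"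
        using cfun.subspace_diff[OF subspace_Dsp f Y[OF g(1)]] g(2)
        by (simp add: Dharm_def clinear_diff[OF clinear_tilde_primed])
      then show "f \<in> (\<lambda>(a, b). a + b) ` (Dharm n e \<times> ?Y ` Dsp n (e - 1))"
        using g(1) by (intro image_eqI[of _ _ "(f - ?Y g, ?Y g)"]) auto
    qed
  qed
qed

lemma direct_sum_Dpiece:
  assumes "2 * e \<le> n"
  shows "is_direct_sum (Dsp n (int e)) {0..e} (Dpiece n (int e))"
  unfolding is_direct_sum_def atLeast0AtMost
proof (intro conjI ballI)
  let ?Y = "tilde_primed n matY"
  show "finite {..e}" by simp
  show "cfun.subspace (Dpiece n (int e) k)" for k
    unfolding Dpiece_def
    by (intro subspace_clinear_image clinear_funpow clinear_tilde_primed subspace_Dharm)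
  show "bij_betw (\<lambda>u. \<Sum>i\<in>{..e}. u i) (Pi\<^sub>E {..e} (Dpiece n (int e))) (Dsp n (int e))"
  proof (rule bij_betw_imageI)
    show "inj_on (\<lambda>u. \<Sum>i\<in>{..e}. u i) (Pi\<^sub>E {..e} (Dpiece n (int e)))"
    proof (rule inj_onI)
      fix u w
      assume u: "u \<in> Pi\<^sub>E {..e} (Dpiece n (int e))" and w: "w \<in> Pi\<^sub>E {..e} (Dpiece n (int e))"
        and eq: "(\<Sum>i\<in>{..e}. u i) = (\<Sum>i\<in>{..e}. w i)"
      \<comment> \<open>Summands are lifted to harmonic polynomials, since uniqueness is known at
        that level.\<close>
      have "\<exists>Q. \<forall>k\<le>e. Q k \<in> Dharm n (int e - int k) \<and> u k = (?Y ^^ k) (Q k)"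
        using u by (intro choice) (auto simp: PiE_iff Dpiece_def image_iff)
      then obtain Q where Q: "\<And>k. k \<le> e \<Longrightarrow> Q k \<in> Dharm n (int e - int k)"
        "\<And>k. k \<le> e \<Longrightarrow> u k = (?Y ^^ k) (Q k)" by blast
      have "\<exists>Q. \<forall>k\<le>e. Q k \<in> Dharm n (int e - int k) \<and> w k = (?Y ^^ k) (Q k)"
        using w by (intro choice) (auto simp: PiE_iff Dpiece_def image_iff)
      then obtain R where R: "\<And>k. k \<le> e \<Longrightarrow> R k \<in> Dharm n (int e - int k)"
        "\<And>k. k \<le> e \<Longrightarrow> w k = (?Y ^^ k) (R k)" by blast
      have "(\<Sum>k\<le>e. (?Y ^^ k) (Q k - R k)) = (\<Sum>k\<le>e. u k - w k)"
        by (rule sum.cong)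
          (auto simp: Q(2) R(2) clinear_diff[OF clinear_funpow[OF clinear_tilde_primed]])
      also have "\<dots> = 0" using eq by (simp add: sum_subtractf)
      finally have "Q k - R k = 0" if "k \<le> e" for k
        using harmonic_decomposition_unique[of e n "\<lambda>k. Q k - R k" k] assms that
          cfun.subspace_diff[OF subspace_Dharm] Q(1) R(1) by blast
      then have "u k = w k" if "k \<le> e" for k
        using that Q(2) R(2) by auto
      then show "u = w" using PiE_ext[OF u w] by simp
    qed
  next
    have piece: "Dpiece n (int e) k \<subseteq> Dsp n (int e)" for k
      using Dsp_Y_pow[OF Dharm_weight(3), of _ n "int e - int k" k] by (auto simp: Dpiece_def)
    show "(\<lambda>u. \<Sum>i\<in>{..e}. u i) ` Pi\<^sub>E {..e} (Dpiece n (int e)) = Dsp n (int e)"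
    proof (intro equalityI subsetI)
      fix f assume "f \<in> (\<lambda>u. \<Sum>i\<in>{..e}. u i) ` Pi\<^sub>E {..e} (Dpiece n (int e))"
      then obtain u where u: "u \<in> Pi\<^sub>E {..e} (Dpiece n (int e))" "f = (\<Sum>i\<in>{..e}. u i)" by blast
      show "f \<in> Dsp n (int e)"
        unfolding u(2)
        by (rule cfun.subspace_sum[OF subspace_Dsp]) (use u(1) piece in \<open>auto simp: PiE_iff\<close>)
    next
      fix f assume "f \<in> Dsp n (int e)"
      then obtain Q where Q: "\<forall>k\<le>e. Q k \<in> Dharm n (int e - int k)"
        "f = (\<Sum>k\<le>e. (?Y ^^ k) (Q k))"
        using harmonic_decomposition[OF assms] by blast
      \<comment> \<open>Families in the product are \<open>undefined\<close> outside the index set,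
        hence the restriction.\<close>
      have "restrict (\<lambda>k. (?Y ^^ k) (Q k)) {..e} \<in> Pi\<^sub>E {..e} (Dpiece n (int e))"
        using Q(1) by (auto simp: Dpiece_def)
      moreover have "f = (\<Sum>k\<in>{..e}. restrict (\<lambda>k. (?Y ^^ k) (Q k)) {..e} k)"
        unfolding Q(2) by (rule sum.cong) auto
      ultimately show "f \<in> (\<lambda>u. \<Sum>i\<in>{..e}. u i) ` Pi\<^sub>E {..e} (Dpiece n (int e))" by blast
    qed
  qed
qed

section \<open>Dimensions\<close>

text \<open>The coordinates of x with respect to B are supported both in A and in B - A, hence
  nowhere.\<close>

lemma span_disjoint_independent:
  assumes B: "cfun.independent B" and "A \<subseteq> B"
    and x: "x \<in> cfun.span A" "x \<in> cfun.span (B - A)"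
  shows "x = 0"
proof -
  have r: "cfun.representation B x = cfun.representation A x"
    "cfun.representation B x = cfun.representation (B - A) x"
    using assms by (intro cfun.representation_extend; auto)+
  have "cfun.representation B x b = 0" for b
    using r cfun.representation_ne_zero[of A x b] cfun.representation_ne_zero[of "B - A" x b] by auto
  moreover have "x \<in> cfun.span B"
    using x(1) \<open>A \<subseteq> B\<close> cfun.span_mono by blast
  ultimately show ?thesis
    using cfun.sum_nonzero_representation_eq[OF B, of x] sum.neutral[of "{}"] by (metis (mono_tags, lifting) empty_Collect_eq sum.empty)
qed

text \<open>A basis A of the kernel is extended to a basis B of V; F is injective on the span of B -
  A and maps B - A to a basis of the image. The space of all functions on
  \<open>nat \<Rightarrow> bit\<close> is infinite-dimensional, so finiteness of B is drawn from the
  spanning set S.\<close>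

lemma rank_nullity:
  assumes F: "clinear F" and V: "cfun.subspace V" "V \<subseteq> cfun.span S" "finite S"
  shows "cfun.dim V = cfun.dim {f \<in> V. F f = 0} + cfun.dim (F ` V)"
proof -
  let ?K = "{f \<in> V. F f = 0}"
  have K: "cfun.subspace ?K"
    using V(1) by (auto simp: subspace_iff clinear_zero[OF F] clinear_add[OF F] clinear_scl[OF F])
  obtain A where A: "A \<subseteq> ?K" "cfun.independent A" "?K \<subseteq> cfun.span A"
    using cfun.maximal_independent_subset by blast
  have "A \<subseteq> V" using A(1) by blast
  then obtain B where B: "A \<subseteq> B" "B \<subseteq> V" "cfun.independent B" "V \<subseteq> cfun.span B"
    using cfun.maximal_independent_subset_extend[OF _ A(2)] by blast
  have fin: "finite B"
    using cfun.independent_span_bound[OF V(3) B(3)] B(2) V(2) by auto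
  have spanB: "cfun.span (B - A) \<subseteq> V"
    using cfun.span_minimal[of "B - A" V] B(2) V(1) by auto
  have inj: "inj_on F (cfun.span (B - A))"
  proof (rule inj_onI)
    fix f g assume f: "f \<in> cfun.span (B - A)" and g: "g \<in> cfun.span (B - A)" and "F f = F g"
    then have "f - g \<in> ?K"
      using cfun.subspace_diff[OF V(1)] spanB by (auto simp: clinear_diff[OF F])
    then have "f - g = 0"
      using span_disjoint_independent[OF B(3,1)] A(3) cfun.span_diff[OF f g] by blast
    then show "f = g" by simp
  qed
  have ind: "cfun.independent (F ` (B - A))"
    using module_hom.independent_injective_image[OF F[unfolded clinear_iff_linear, folded module_hom_iff_linear]
        cfun.independent_mono[OF B(3)] inj] by blast
  have "F ` V \<subseteq> cfun.span (F ` (B - A))"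
  proof
    fix y assume "y \<in> F ` V"
    then obtain f where f: "f \<in> V" "y = F f" by blast
    have "f \<in> cfun.span (A \<union> (B - A))" using f(1) B(1,4) by (auto simp: Un_absorb1)
    then obtain a b where ab: "a \<in> cfun.span A" "b \<in> cfun.span (B - A)" "f = a + b"
      unfolding cfun.span_Un by blast
    have "a \<in> ?K" using cfun.span_minimal[OF A(1) K] ab(1) by blast
    then have "y = F b" by (simp add: f(2) ab(3) clinear_add[OF F])
    then show "y \<in> cfun.span (F ` (B - A))"
      using ab(2) clinear_image_span[OF F, of "B - A"] by blast
  qed
  then have "cfun.dim (F ` V) = card (F ` (B - A))"
    using cfun.dim_unique[of "F ` (B - A)" "F ` V"] ind B(2) by blast
  also have "\<dots> = card (B - A)"
    by (rule card_image) (rule inj_on_subset[OF inj cfun.span_superset])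
  finally have "cfun.dim (F ` V) = card (B - A)" .
  moreover have "cfun.dim ?K = card A" "cfun.dim V = card B"
    using cfun.dim_unique[OF A(1) A(3) A(2) refl] cfun.dim_unique[OF B(2) B(4) B(3) refl] by auto
  moreover have "card B = card A + card (B - A)"
    using B(1) fin by (metis card_Diff_subset card_mono finite_subset le_add_diff_inverse)
  ultimately show ?thesis by simp
qed

section \<open>Orthogonality of the characters\<close>

lemma UNIV_bit: "(UNIV :: bit set) = {0, 1}"
  by (auto intro: bit.exhaust)

lemma sum_pure_tensor:
  "(\<Sum>v\<in>F2n n. pure_tensor n g v) = (\<Prod>j\<in>{1..n}. g j $ 1 + g j $ 2)"
proof -
  have "(\<Prod>j\<in>{1..n}. \<Sum>b\<in>(UNIV :: bit set). g j $ pos b) =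
      (\<Sum>v\<in>F2n n. \<Prod>j\<in>{1..n}. g j $ pos (v j))"
    unfolding F2n_def by (rule prod_sum_PiE) (auto simp: UNIV_bit)
  moreover have "(\<Sum>b\<in>(UNIV :: bit set). g j $ pos b) = g j $ 1 + g j $ 2" for j
    by (simp add: UNIV_bit pos_def)
  ultimately show ?thesis by (simp add: pure_tensor_def)
qed

text \<open>The product of two characters is the character of the symmetric difference of J and K.
  Its sum factors over the coordinates, and a coordinate in the symmetric difference contributes 1 +
  (-1) = 0.\<close>

lemma sum_monomial_mult:
  assumes "J \<subseteq> {1..n}" "K \<subseteq> {1..n}"
  shows "(\<Sum>v\<in>F2n n. monomial_fun n K v * monomial_fun n J v) = (if J = K then 2 ^ n else 0)"
proof -
  define g where "g j = (if (j \<in> J) = (j \<in> K) then vec_one else vec_sign)" for j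
  have "monomial_fun n K v * monomial_fun n J v = pure_tensor n g v" for v
    unfolding monomial_eq_ptens[OF assms(1)] monomial_eq_ptens[OF assms(2)]
    by (auto simp: ptens_def pure_tensor_def prod.distrib[symmetric] g_def vec_one_def vec_sign_def pos_def
        intro!: prod.cong)
  then have "(\<Sum>v\<in>F2n n. monomial_fun n K v * monomial_fun n J v) =
      (\<Prod>j\<in>{1..n}. g j $ 1 + g j $ 2)"
    by (simp only: sum_pure_tensor)
  also have "\<dots> = (\<Prod>j\<in>{1..n}. if (j \<in> J) = (j \<in> K) then 2 else 0)"
    by (rule prod.cong) (auto simp: g_def vec_one_def vec_sign_def)
  also have "\<dots> = (if J = K then 2 ^ n else 0)"
  proof (cases "J = K")
    case False
    then obtain j where "j \<in> {1..n}" "(j \<in> J) \<noteq> (j \<in> K)" using assms by blast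
    then have "(\<Prod>j\<in>{1..n}. if (j \<in> J) = (j \<in> K) then 2 else 0 :: complex) = 0"
      by (intro prod_zero) (auto intro!: bexI[of _ j])
    then show ?thesis using False by simp
  qed simp
  finally show ?thesis .
qed

lemma inj_on_monomial: "inj_on (monomial_fun n) (Pow {1..n})"
proof (rule inj_onI)
  fix J K assume JK: "J \<in> Pow {1..n}" "K \<in> Pow {1..n}" "monomial_fun n J = monomial_fun n K"
  then have "(if K = J then 2 ^ n else 0 :: complex) = (if J = J then 2 ^ n else 0)"
    using sum_monomial_mult[of K n J] sum_monomial_mult[of J n J] by simp
  then show "J = K" by (auto split: if_splits)
qed

lemma independent_monomials:
  assumes "\<J> \<subseteq> Pow {1..n}"
  shows "cfun.independent (monomial_fun n ` \<J>)"
proof (rule cfun.independent_if_scalars_zero)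
  have fin: "finite \<J>" using assms finite_subset by blast
  then show "finite (monomial_fun n ` \<J>)" by simp
  fix c x assume sum0: "(\<Sum>x\<in>monomial_fun n ` \<J>. (\<lambda>v. c x * x v)) = 0"
    and x: "x \<in> monomial_fun n ` \<J>"
  then obtain K where K: "K \<in> \<J>" "x = monomial_fun n K" by blast
  have inj: "inj_on (monomial_fun n) \<J>"
    using inj_on_monomial assms inj_on_subset by blast
  have "(\<Sum>J\<in>\<J>. c (monomial_fun n J) * monomial_fun n J v) = 0" for v
    using fun_cong[OF sum0, of v] by (simp add: sum.reindex[OF inj] sum_fun_app)
  \<comment> \<open>Pairing the linear relation with the character of K isolates the coefficient at
    K.\<close>
  then have "0 = (\<Sum>v\<in>F2n n. monomial_fun n K v * (\<Sum>J\<in>\<J>. c (monomial_fun n J) * monomial_fun n J v))"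
    by simp
  also have "\<dots> = (\<Sum>J\<in>\<J>. c (monomial_fun n J) * (\<Sum>v\<in>F2n n. monomial_fun n K v * monomial_fun n J v))"
    unfolding sum_distrib_left by (subst sum.swap) (simp add: algebra_simps)
  also have "\<dots> = (\<Sum>J\<in>\<J>. if J = K then c (monomial_fun n J) * 2 ^ n else 0)"
    by (rule sum.cong[OF refl], subst sum_monomial_mult) (use assms K in auto)
  also have "\<dots> = c x * 2 ^ n"
    using fin K by simp
  finally show "c x = 0" by simp
qed

lemma Dsp_eq_span_image:
  "Dsp n e = cfun.span (monomial_fun n ` {J. J \<subseteq> {1..n} \<and> int (card J) = e})"
  unfolding Dsp_def by (rule arg_cong[of _ _ cfun.span]) blast

lemma dim_Dsp: "int (cfun.dim (Dsp n e)) = binom n e"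
proof -
  let ?J = "{J. J \<subseteq> {1..n} \<and> int (card J) = e}"
  have sub: "?J \<subseteq> Pow {1..n}" by blast
  have "cfun.dim (Dsp n e) = card (monomial_fun n ` ?J)"
    unfolding Dsp_eq_span_image
    by (rule cfun.dim_span_eq_card_independent) (rule independent_monomials[OF sub])
  also have "\<dots> = card ?J"
    by (rule card_image) (rule inj_on_subset[OF inj_on_monomial sub])
  also have "int (card ?J) = binom n e"
  proof (cases "e < 0")
    case True
    then have "?J = {}" by auto
    then show ?thesis using True by (simp only: binom_def) simp
  next
    case False
    then have "?J = {J. J \<subseteq> {1..n} \<and> card J = nat e}" by auto
    then show ?thesis using False n_subsets[of "{1..n}" "nat e"] by (simp add: binom_def)
  qed
  finally show ?thesis .
qed

text \<open>Rank and nullity of X' on degree e, whose image is all of degree e - 1. The additive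
  form avoids subtraction of natural numbers.\<close>

lemma dim_Dharm:
  assumes "2 * e \<le> int n"
  shows "cfun.dim (Dsp n e) = cfun.dim (Dharm n e) + cfun.dim (Dsp n (e - 1))"
proof -
  let ?S = "monomial_fun n ` {J. J \<subseteq> {1..n} \<and> int (card J) = e}"
  have "finite ?S" by (rule finite_imageI, rule finite_subset[of _ "Pow {1..n}"]) auto
  then have "cfun.dim (Dsp n e) = cfun.dim {f \<in> Dsp n e. tilde_primed n matX f = 0} +
      cfun.dim (tilde_primed n matX ` Dsp n e)"
    by (intro rank_nullity[OF clinear_tilde_primed subspace_Dsp, of n e ?S])
      (simp_all add: Dsp_eq_span_image)
  then show ?thesis
    by (simp add: Dharm_def X_image_Dsp[OF assms])
qed

section \<open>Modules and quotients\<close>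

lemma sl2_iff: "A \<in> sl2 \<longleftrightarrow> A $ 2 $ 2 = - A $ 1 $ 1"
  by (auto simp: sl2_def trace_def UNIV_2 add_eq_0_iff)

lemma sl2_add: "A \<in> sl2 \<Longrightarrow> B \<in> sl2 \<Longrightarrow> A + B \<in> sl2"
  by (simp add: sl2_iff)

lemma sl2_mat: "A \<in> sl2 \<Longrightarrow> mat c ** A \<in> sl2"
  by (simp add: sl2_iff matrix_matrix_mult_def UNIV_2 mat_def)

lemma sl2_bracket: "A ** B - B ** A \<in> sl2"
  by (simp add: sl2_iff matrix_matrix_mult_def UNIV_2)

lemma cring_complex_ring: "cring complex_ring"
proof (rule cringI)
  show "abelian_group complex_ring"
  proof (rule abelian_groupI)
    fix x assume "x \<in> carrier complex_ring"
    show "\<exists>y\<in>carrier complex_ring. y \<oplus>\<^bsub>complex_ring\<^esub> x = \<zero>\<^bsub>complex_ring\<^esub>"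
      by (intro bexI[of _ "- x"]) (simp_all add: complex_ring_def)
  qed (simp_all add: complex_ring_def)
  show "comm_monoid complex_ring"
    by (rule comm_monoidI) (simp_all add: complex_ring_def)
qed (simp add: complex_ring_def algebra_simps)

lemma cfun_module_simps:
  "carrier (cfun_module W) = W" "f \<oplus>\<^bsub>cfun_module W\<^esub> g = f + g"
  "\<zero>\<^bsub>cfun_module W\<^esub> = 0" "c \<odot>\<^bsub>cfun_module W\<^esub> f = scl c f"
  by (simp_all add: cfun_module_def scl_def)

lemma complex_ring_simps:
  "carrier complex_ring = UNIV" "a \<oplus>\<^bsub>complex_ring\<^esub> b = a + b"
  "a \<otimes>\<^bsub>complex_ring\<^esub> b = a * b" "\<one>\<^bsub>complex_ring\<^esub> = 1"
  by (simp_all add: complex_ring_def)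

lemma module_cfun:
  assumes "cfun.subspace W"
  shows "Module.module complex_ring (cfun_module W)"
proof (rule moduleI[OF cring_complex_ring])
  show "abelian_group (cfun_module W)"
  proof (rule abelian_groupI)
    fix f assume "f \<in> carrier (cfun_module W)"
    then show "\<exists>g\<in>carrier (cfun_module W). g \<oplus>\<^bsub>cfun_module W\<^esub> f = \<zero>\<^bsub>cfun_module W\<^esub>"
      using cfun.subspace_neg[OF assms]
      by (intro bexI[of _ "- f"]) (simp_all only: cfun_module_simps left_minus)
  qed (use cfun.subspace_add[OF assms] cfun.subspace_0[OF assms] in
      \<open>simp_all only: cfun_module_simps ac_simps add_0_left add_0_right\<close>)
qed (use subspace_scl[OF assms] in
    \<open>simp_all only: cfun_module_simps complex_ring_simps scl_distribs scl_simps\<close>)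

lemma cfun_module_minus:
  assumes "cfun.subspace W" "f \<in> W" "g \<in> W"
  shows "f \<ominus>\<^bsub>cfun_module W\<^esub> g = f - g"
proof -
  interpret Module.module complex_ring "cfun_module W"
    by (rule module_cfun[OF assms(1)])
  have "\<ominus>\<^bsub>cfun_module W\<^esub> g = - g"
    by (rule M.minus_equality) (use assms cfun.subspace_neg in \<open>auto simp: cfun_module_simps\<close>)
  then show ?thesis by (simp add: a_minus_def cfun_module_simps)
qed

lemma sl2_module_cfun:
  assumes "cfun.subspace W"
    and "\<And>A f. A \<in> sl2 \<Longrightarrow> f \<in> W \<Longrightarrow> \<rho> A f \<in> W"
    and "\<And>A. clinear (\<rho> A)"
    and "\<And>A B f. \<rho> (A + B) f = \<rho> A f + \<rho> B f"
    and "\<And>c A f. \<rho> (mat c ** A) f = scl c (\<rho> A f)"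
    and "\<And>A B f. \<rho> (A ** B - B ** A) f = \<rho> A (\<rho> B f) - \<rho> B (\<rho> A f)"
  shows "sl2_module (cfun_module W) \<rho>"
proof -
  show ?thesis
    by (intro sl2_module.intro module_cfun sl2_module_axioms.intro)
      (simp_all add: cfun_module_simps assms(1,2,4-6) cfun_module_minus clinear_add[OF assms(3)] clinear_scl[OF assms(3)])
qed

text \<open>The module laws of M' are transported along the bijection, so they need no direct check
  for cosets. Preservation of zero is asked for because M' is not yet known to be a group.\<close>

lemma sl2_isomorphic_transport:
  assumes M: "sl2_module M \<rho>" and bij: "bij_betw \<phi> (carrier M) (carrier M')"
    and zero: "\<phi> \<zero>\<^bsub>M\<^esub> = \<zero>\<^bsub>M'\<^esub>"
    and add: "\<And>x y. x \<in> carrier M \<Longrightarrow> y \<in> carrier M \<Longrightarrow> \<phi> (x \<oplus>\<^bsub>M\<^esub> y) = \<phi> x \<oplus>\<^bsub>M'\<^esub> \<phi> y"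
    and smult: "\<And>c x. x \<in> carrier M \<Longrightarrow> \<phi> (c \<odot>\<^bsub>M\<^esub> x) = c \<odot>\<^bsub>M'\<^esub> \<phi> x"
    and act: "\<And>A x. A \<in> sl2 \<Longrightarrow> x \<in> carrier M \<Longrightarrow> \<phi> (\<rho> A x) = \<rho>' A (\<phi> x)"
  shows "sl2_isomorphic M \<rho> M' \<rho>'"
proof -
  interpret M: sl2_module M \<rho> by (rule M)
  have carr: "carrier M' = \<phi> ` carrier M"
    using bij by (simp add: bij_betw_def)
  note ring = complex_ring_simps
  have smult_closed: "c \<odot>\<^bsub>M\<^esub> x \<in> carrier M" if "x \<in> carrier M" for c x
    using M.smult_closed[of c x] that by (simp add: ring)
  have group: "abelian_group M'"
  proof (rule abelian_groupI)
    fix x assume "x \<in> carrier M'"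
    then obtain u where u: "u \<in> carrier M" "x = \<phi> u" by (auto simp: carr)
    show "\<exists>y\<in>carrier M'. y \<oplus>\<^bsub>M'\<^esub> x = \<zero>\<^bsub>M'\<^esub>"
      using u by (intro bexI[of _ "\<phi> (\<ominus>\<^bsub>M\<^esub> u)"])
        (simp_all add: carr flip: add zero add: M.M.l_neg)
  qed (auto simp: carr M.M.a_ac simp flip: add zero)
  have mod: "Module.module complex_ring M'"
    by (rule moduleI[OF cring_complex_ring group])
      (auto simp: carr ring smult_closed simp flip: add smult
        simp: M.smult_l_distr[simplified ring] M.smult_r_distr[simplified ring]
          M.smult_assoc1[simplified ring] M.smult_one[simplified ring])
  interpret M': Module.module complex_ring M' by (rule mod)
  have minus: "\<phi> (x \<ominus>\<^bsub>M\<^esub> y) = \<phi> x \<ominus>\<^bsub>M'\<^esub> \<phi> y" if "x \<in> carrier M" "y \<in> carrier M" for x y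
  proof -
    have "\<ominus>\<^bsub>M'\<^esub> \<phi> y = \<phi> (\<ominus>\<^bsub>M\<^esub> y)"
      by (rule M'.M.minus_equality) (use that in \<open>simp_all add: carr M.M.l_neg flip: add zero\<close>)
    then show ?thesis using that by (simp add: a_minus_def add)
  qed
  have "sl2_module M' \<rho>'"
    by (intro sl2_module.intro mod sl2_module_axioms.intro)
      (auto simp: carr smult_closed M.act_closed M.act_add M.act_smult M.add_act M.smult_act M.bracket_act
        sl2_add sl2_mat sl2_bracket simp flip: add smult minus act)
  then show ?thesis
    unfolding sl2_isomorphic_def using assms by blast
qed

text \<open>The first isomorphism theorem read backwards: w goes to the fibre of
  \<open>\<psi>\<close> over w, and the fibres are the cosets of the kernel N.\<close>

lemma sl2_isomorphic_quotient:
  assumes W: "sl2_module (cfun_module W) \<rho>" "cfun.subspace W"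
    and V: "cfun.subspace V" and \<psi>: "clinear \<psi>" "\<psi> ` V = W" "N = {f \<in> V. \<psi> f = 0}"
    and act: "\<And>A f. A \<in> sl2 \<Longrightarrow> f \<in> V \<Longrightarrow> \<rho>V A f \<in> V"
      "\<And>A f. A \<in> sl2 \<Longrightarrow> f \<in> V \<Longrightarrow> \<psi> (\<rho>V A f) = \<rho> A (\<psi> f)"
  shows "sl2_isomorphic (cfun_module W) \<rho> (quotient_module (cfun_module V) N) (quotient_action (cfun_module V) N \<rho>V)"
proof -
  define \<phi> where "\<phi> w = {f \<in> V. \<psi> f = w}" for w
  note mod = cfun_module_simps
  have coset: "N +>\<^bsub>cfun_module V\<^esub> f = \<phi> (\<psi> f)" if f: "f \<in> V" for f
  proof
    show "N +>\<^bsub>cfun_module V\<^esub> f \<subseteq> \<phi> (\<psi> f)"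
      using f cfun.subspace_add[OF V]
      by (auto simp: a_r_coset_def' mod \<phi>_def \<psi>(3) clinear_add[OF \<psi>(1)])
    show "\<phi> (\<psi> f) \<subseteq> N +>\<^bsub>cfun_module V\<^esub> f"
    proof
      fix g assume "g \<in> \<phi> (\<psi> f)"
      then have "g - f \<in> N" "g = (g - f) + f"
        using f cfun.subspace_diff[OF V] by (auto simp: \<phi>_def \<psi>(3) clinear_diff[OF \<psi>(1)])
      then show "g \<in> N +>\<^bsub>cfun_module V\<^esub> f"
        unfolding a_r_coset_def' mod by blast
    qed
  qed
  have ne: "\<exists>f\<in>V. \<psi> f = w \<and> f \<in> \<phi> w" if "w \<in> W" for w
    using that by (auto simp: \<phi>_def simp flip: \<psi>(2))
  \<comment> \<open>The quotient operations are unions over all representatives. Here all cosets in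
    the union are the same fibre, and nonemptiness of the index set makes the union equal to
    it.\<close>
  have union: "(\<Union>s\<in>\<phi> w. N +>\<^bsub>cfun_module V\<^esub> F s) = \<phi> u"
    if "w \<in> W" "\<And>s. s \<in> \<phi> w \<Longrightarrow> F s \<in> V \<and> \<psi> (F s) = u" for w u F
    using ne[OF that(1)] that(2) by (auto simp: coset)
  show ?thesis
  proof (rule sl2_isomorphic_transport[OF W(1), where \<phi> = \<phi>])
    have "inj_on \<phi> W"
      using ne by (intro inj_onI) (metis (mono_tags, lifting) \<phi>_def mem_Collect_eq)
    moreover have "\<phi> ` W = a_rcosets\<^bsub>cfun_module V\<^esub> N"
      by (auto simp: A_RCOSETS_def' mod coset simp flip: \<psi>(2))
    ultimately show "bij_betw \<phi> (carrier (cfun_module W)) (carrier (quotient_module (cfun_module V) N))"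
      by (simp add: bij_betw_def mod quotient_module_def)
    show "\<phi> \<zero>\<^bsub>cfun_module W\<^esub> = \<zero>\<^bsub>quotient_module (cfun_module V) N\<^esub>"
      by (simp add: quotient_module_def cfun_module_def \<phi>_def \<psi>(3))
  next
    fix x y assume "x \<in> carrier (cfun_module W)" "y \<in> carrier (cfun_module W)"
    then have xy: "x \<in> W" "y \<in> W" by (simp_all add: mod)
    have "\<phi> (x + y) = {f + g |f g. f \<in> \<phi> x \<and> g \<in> \<phi> y}"
    proof (intro equalityI subsetI)
      fix h assume h: "h \<in> \<phi> (x + y)"
      obtain f where f: "f \<in> V" "\<psi> f = x" "f \<in> \<phi> x" using ne[OF xy(1)] by blast
      have "h - f \<in> \<phi> y" "h = f + (h - f)"
        using h f cfun.subspace_diff[OF V] by (auto simp: \<phi>_def clinear_diff[OF \<psi>(1)])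
      then show "h \<in> {f + g |f g. f \<in> \<phi> x \<and> g \<in> \<phi> y}" using f(3) by blast
    qed (use cfun.subspace_add[OF V] in \<open>auto simp: \<phi>_def clinear_add[OF \<psi>(1)]\<close>)
    then show "\<phi> (x \<oplus>\<^bsub>cfun_module W\<^esub> y) = \<phi> x \<oplus>\<^bsub>quotient_module (cfun_module V) N\<^esub> \<phi> y"
      by (auto simp: quotient_module_def mod set_add_def')
  next
    fix c x assume "x \<in> carrier (cfun_module W)"
    then have "(\<Union>s\<in>\<phi> x. N +>\<^bsub>cfun_module V\<^esub> scl c s) = \<phi> (scl c x)"
      using subspace_scl[OF V] by (intro union) (auto simp: mod \<phi>_def clinear_scl[OF \<psi>(1)])
    then show "\<phi> (c \<odot>\<^bsub>cfun_module W\<^esub> x) = c \<odot>\<^bsub>quotient_module (cfun_module V) N\<^esub> \<phi> x"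
      by (simp add: quotient_module_def mod)
  next
    fix A :: "complex^2^2" and x assume "A \<in> sl2" "x \<in> carrier (cfun_module W)"
    then have "(\<Union>s\<in>\<phi> x. N +>\<^bsub>cfun_module V\<^esub> \<rho>V A s) = \<phi> (\<rho> A x)"
      using act by (intro union) (auto simp: mod \<phi>_def)
    then show "\<phi> (\<rho> A x) = quotient_action (cfun_module V) N \<rho>V A (\<phi> x)"
      by (simp add: quotient_action_def)
  qed
qed

section \<open>The module generated by a highest weight vector\<close>

lemma sl2_decompose:
  assumes "A \<in> sl2"
  shows "A = mat (A $ 1 $ 1) ** matH + mat (A $ 1 $ 2) ** matX + mat (A $ 2 $ 1) ** matY"
  using assms
  by (simp add: sl2_iff vec_eq_iff forall_2 matrix_matrix_mult_def UNIV_2 mat_def matX_def matY_def matH_def)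

text \<open>Isolates what the representation theory needs from a harmonic polynomial; its degree
  enters only through the weight m.\<close>

locale highest_weight_vector =
  fixes n m :: nat and v :: "(nat \<Rightarrow> bit) \<Rightarrow> complex"
  assumes nonzero: "v \<noteq> 0"
    and X_v: "tilde_primed n matX v = 0"
    and H_v: "tilde_primed n matH v = scl (of_nat m) v"
    and Y_top: "(tilde_primed n matY ^^ Suc m) v = 0"
begin

abbreviation y :: "nat \<Rightarrow> (nat \<Rightarrow> bit) \<Rightarrow> complex" where
  "y k \<equiv> (tilde_primed n matY ^^ k) v"

definition W :: "((nat \<Rightarrow> bit) \<Rightarrow> complex) set" where
  "W = cfun.span {y j | j. j \<in> {0..m}}"

text \<open>For k = 0 the term \<open>y (k - 1)\<close> is \<open>y 0\<close> by truncated
  subtraction, but its coefficient vanishes.\<close>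

lemma act_y:
  assumes "A \<in> sl2"
  shows "tilde_primed n A (y k) = scl (A $ 1 $ 1 * (of_nat m - 2 * of_nat k)) (y k) +
    scl (A $ 1 $ 2 * (of_nat k * (of_nat m - of_nat k + 1))) (y (k - 1)) + scl (A $ 2 $ 1) (y (Suc k))"
proof -
  have X: "tilde_primed n matX (y k) = scl (of_nat k * (of_nat m - of_nat k + 1)) (y (k - 1))"
  proof (cases k)
    case 0
    then show ?thesis by (simp add: X_v)
  next
    case (Suc i)
    then show ?thesis using X_Y_pow[OF X_v H_v, of i] by (simp add: algebra_simps del: funpow.simps)
  qed
  have "tilde_primed n A (y k) = scl (A $ 1 $ 1) (tilde_primed n matH (y k)) +
      scl (A $ 1 $ 2) (tilde_primed n matX (y k)) + scl (A $ 2 $ 1) (tilde_primed n matY (y k))"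
    by (subst sl2_decompose[OF assms]) (simp only: tilde_primed_add tilde_primed_mat)
  then show ?thesis
    by (simp add: X H_Y_pow[OF H_v])
qed

lemma subspace_W: "cfun.subspace W"
  by (simp only: W_def cfun.subspace_span)

lemma y_in_W: "y k \<in> W"
proof (cases "k \<le> m")
  case True
  then show ?thesis unfolding W_def by (intro cfun.span_base) auto
next
  case False
  then have "y k = (tilde_primed n matY ^^ (k - Suc m)) (y (Suc m))"
    using funpow_add[of "k - Suc m" "Suc m" "tilde_primed n matY"]
    by (simp del: funpow.simps)
  then have "y k = 0"
    unfolding Y_top by (simp only: clinear_zero[OF clinear_funpow[OF clinear_tilde_primed]])
  then show ?thesis using cfun.subspace_0[OF subspace_W] by simp
qed

lemma W_minimal:
  assumes "cfun.subspace S" "\<And>k. k \<le> m \<Longrightarrow> y k \<in> S"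
  shows "W \<subseteq> S"
  unfolding W_def by (rule cfun.span_minimal) (use assms in auto)

lemma W_closed:
  assumes A: "A \<in> sl2" and f: "f \<in> W"
  shows "tilde_primed n A f \<in> W"
proof -
  have "cfun.subspace {f. tilde_primed n A f \<in> W}"
    using subspace_W
    by (simp add: subspace_iff clinear_zero[OF clinear_tilde_primed]
      clinear_add[OF clinear_tilde_primed] clinear_scl[OF clinear_tilde_primed])
  moreover have "tilde_primed n A (y k) \<in> W" for k
    unfolding act_y[OF A]
    by (intro cfun.subspace_add[OF subspace_W] subspace_scl[OF subspace_W] y_in_W)
  ultimately have "W \<subseteq> {f. tilde_primed n A f \<in> W}"
    by (intro W_minimal) auto
  then show ?thesis using f by blast
qed

lemma sl2_module_W: "sl2_module (cfun_module W) (tilde_primed n)"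
  by (rule sl2_module_cfun[OF subspace_W W_closed clinear_tilde_primed tilde_primed_add
        tilde_primed_mat tilde_primed_bracket])

lemma W_coordinates:
  assumes "f \<in> W"
  obtains a where "f = (\<Sum>k\<le>m. scl (a k) (y k))"
proof -
  let ?S = "range (\<lambda>a. \<Sum>k\<le>m. scl (a k) (y k))"
  have "cfun.subspace ?S"
    unfolding subspace_iff
  proof (intro conjI ballI allI)
    show "0 \<in> ?S" by (intro range_eqI[of _ _ "\<lambda>_. 0"]) simp
  next
    fix f g assume "f \<in> ?S" "g \<in> ?S"
    then obtain a b where "f = (\<Sum>k\<le>m. scl (a k) (y k))" "g = (\<Sum>k\<le>m. scl (b k) (y k))" by blast
    then show "f + g \<in> ?S"
      by (intro range_eqI[of _ _ "\<lambda>k. a k + b k"]) (simp only: sum.distrib scl_distribs)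
  next
    fix c f assume "f \<in> ?S"
    then obtain a where "f = (\<Sum>k\<le>m. scl (a k) (y k))" by blast
    then show "scl c f \<in> ?S"
      by (intro range_eqI[of _ _ "\<lambda>k. c * a k"]) (simp only: scl_sum scl_simps)
  qed
  moreover have "y k \<in> ?S" if "k \<le> m" for k
  proof (rule range_eqI[of _ _ "\<lambda>i. if i = k then 1 else 0"])
    have "(\<Sum>i\<le>m. scl (if i = k then 1 else 0) (y i)) = (\<Sum>i\<le>m. if i = k then y i else 0)"
      by (rule sum.cong) auto
    then show "y k = (\<Sum>i\<le>m. scl (if i = k then 1 else 0) (y i))"
      using that by simp
  qed
  ultimately have "W \<subseteq> ?S" by (rule W_minimal)
  then show ?thesis using assms that by blast
qed

section \<open>Leading coefficients and irreducibility\<close>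

lemma X_pow_y:
  "i < j \<Longrightarrow> (tilde_primed n matX ^^ j) (y i) = 0"
  "(tilde_primed n matX ^^ j) (y j) = scl (\<Prod>i<j. of_nat (Suc i) * (of_nat m - of_nat i)) v"
proof (induction j arbitrary: i)
  case 0
  { case 1 then show ?case by simp }
  { case 2 then show ?case by simp }
next
  case (Suc j)
  have step: "(tilde_primed n matX ^^ Suc j) (y (Suc i)) =
      scl (of_nat (Suc i) * (of_nat m - of_nat i)) ((tilde_primed n matX ^^ j) (y i))" for i
    unfolding funpow_Suc_right o_apply[of "tilde_primed n matX ^^ j"] X_Y_pow[OF X_v H_v, unfolded funpow_Suc_right]
    using X_Y_pow[OF X_v H_v, of i]
    by (simp only: clinear_scl[OF clinear_funpow[OF clinear_tilde_primed]] funpow_Suc_right)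
  { case 1
    show ?case
    proof (cases i)
      case 0
      then show ?thesis
        by (simp add: funpow_Suc_right X_v clinear_zero[OF clinear_funpow[OF clinear_tilde_primed]]
            del: funpow.simps(2))
    next
      case (Suc i')
      then have "(tilde_primed n matX ^^ j) (y i') = 0" using 1 by (intro Suc.IH(1)) simp
      then show ?thesis using step[of i'] by (simp only: \<open>i = Suc i'\<close> scl_simps)
    qed }
  { case 2
    show ?case using step[of j] Suc.IH(2) by (simp add: mult.commute) }
qed

text \<open>X'^J kills each \<open>y k\<close> with k < J, and the coefficients beyond J vanish, so
  only the leading term survives. Its factors m - i are nonzero as i < J and J is at most m.\<close>

lemma extract_leading:
  assumes "f = (\<Sum>k\<le>m. scl (a k) (y k))" "J \<le> m" "a J \<noteq> 0" "\<And>k. J < k \<Longrightarrow> k \<le> m \<Longrightarrow> a k = 0"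
  obtains c where "c \<noteq> 0" "(tilde_primed n matX ^^ J) f = scl c v"
proof
  let ?p = "\<Prod>i<J. of_nat (Suc i) * (of_nat m - of_nat i) :: complex"
  have "of_nat m - of_nat i \<noteq> (0 :: complex)" if "i < J" for i
    using assms(2) that by (simp flip: of_nat_diff)
  then show "a J * ?p \<noteq> 0"
    using assms(3) by (simp del: of_nat_Suc)
  have "(tilde_primed n matX ^^ J) f = (\<Sum>k\<le>m. scl (a k) ((tilde_primed n matX ^^ J) (y k)))"
    unfolding assms(1) by (simp only: clinear_sum[OF clinear_funpow[OF clinear_tilde_primed]]
        clinear_scl[OF clinear_funpow[OF clinear_tilde_primed]])
  also have "\<dots> = (\<Sum>k\<le>m. if k = J then scl (a J * ?p) v else 0)"
  proof (rule sum.cong[OF refl])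
    fix k assume "k \<in> {..m}"
    then show "scl (a k) ((tilde_primed n matX ^^ J) (y k)) = (if k = J then scl (a J * ?p) v else 0)"
      using X_pow_y(1)[of k J] X_pow_y(2)[of J] assms(4)[of k]
      by (cases k J rule: linorder_cases) (simp_all only: scl_simps atMost_iff if_True if_False refl less_irrefl, auto)
  qed
  also have "\<dots> = scl (a J * ?p) v"
    using assms(2) by simp
  finally show "(tilde_primed n matX ^^ J) f = scl (a J * ?p) v" .
qed

text \<open>Taking J as the largest index with nonzero coefficient, X'^J would turn the relation
  into a nonzero multiple of v equal to 0.\<close>

lemma y_independent:
  assumes "(\<Sum>k\<le>m. scl (a k) (y k)) = 0" "k \<le> m"
  shows "a k = 0"
proof (rule ccontr)
  assume "a k \<noteq> 0"
  define J where "J = Max {k. k \<le> m \<and> a k \<noteq> 0}"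
  have fin: "finite {k. k \<le> m \<and> a k \<noteq> 0}" by simp
  have J: "J \<le> m" "a J \<noteq> 0"
    using Max_in[OF fin] \<open>a k \<noteq> 0\<close> assms(2) unfolding J_def by blast+
  have "a k = 0" if "J < k" "k \<le> m" for k
    using Max_ge[OF fin, of k] that unfolding J_def[symmetric] by fastforce
  then obtain c where "c \<noteq> 0" "(tilde_primed n matX ^^ J) 0 = scl c v"
    using extract_leading[OF assms(1)[symmetric] J] by blast
  then show False
    using nonzero by (simp add: clinear_zero[OF clinear_funpow[OF clinear_tilde_primed]])
qed

lemma matXY_sl2: "matX \<in> sl2" "matY \<in> sl2"
  by (simp_all add: sl2_iff matX_def matY_def)

text \<open>Powers of X' bring a nonzero element of an invariant submodule to a nonzero multiple of
  v, and powers of Y' then produce every \<open>y k\<close>.\<close>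

lemma sl2_irreducible_W: "sl2_irreducible (cfun_module W) (tilde_primed n)"
  unfolding sl2_irreducible_def
proof (intro conjI allI impI sl2_module_W)
  have "v \<in> W" using y_in_W[of 0] by simp
  then show "carrier (cfun_module W) \<noteq> {\<zero>\<^bsub>cfun_module W\<^esub>}"
    unfolding cfun_module_simps using nonzero by blast
next
  fix N assume N: "submodule N complex_ring (cfun_module W) \<and> (\<forall>A\<in>sl2. tilde_primed n A ` N \<subseteq> N)"
  interpret M: Module.module complex_ring "cfun_module W"
    by (rule module_cfun[OF subspace_W])
  have sub: "cfun.subspace N"
    unfolding subspace_iff
  proof (intro conjI ballI allI)
    interpret N: submodule N complex_ring "cfun_module W" using N by blast
    \<comment> \<open>A submodule is a subgroup of the additive monoid, so \<open>one_closed\<close>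
      and \<open>m_closed\<close> speak of zero and addition.\<close>
    show "0 \<in> N" using N.one_closed by (simp only: monoid.simps cfun_module_simps)
    show "f + g \<in> N" if "f \<in> N" "g \<in> N" for f g
      using N.m_closed[OF that] by (simp only: monoid.simps cfun_module_simps)
    show "scl c f \<in> N" if "f \<in> N" for c f
      using N.smult_closed[OF _ that, of c] by (simp only: complex_ring_simps cfun_module_simps UNIV_I)
  qed
  have NW: "N \<subseteq> W"
    using M.submoduleE(1)[OF conjunct1[OF N]] by (simp add: cfun_module_simps)
  have closed: "(tilde_primed n A ^^ k) f \<in> N" if "A \<in> sl2" "f \<in> N" for A k f
  proof (induction k)
    case (Suc k)
    then show ?case using that(1) N unfolding funpow.simps o_apply by blast
  qed (use that in simp)
  have "N = W" if nz: "N \<noteq> {0}"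
  proof -
    obtain f where f: "f \<in> N" "f \<noteq> 0"
      using nz cfun.subspace_0[OF sub] by blast
    obtain a where a: "f = (\<Sum>k\<le>m. scl (a k) (y k))"
      using W_coordinates f(1) NW by blast
    define J where "J = Max {k. k \<le> m \<and> a k \<noteq> 0}"
    have fin: "finite {k. k \<le> m \<and> a k \<noteq> 0}" by simp
    have "\<exists>k\<le>m. a k \<noteq> 0"
    proof (rule ccontr)
      assume "\<not> ?thesis"
      then have "(\<Sum>k\<le>m. scl (a k) (y k)) = 0" by (intro sum.neutral) auto
      then show False using f(2) a by metis
    qed
    then have J: "J \<le> m" "a J \<noteq> 0"
      using Max_in[OF fin] unfolding J_def by blast+
    have "a k = 0" if "J < k" "k \<le> m" for k
      using Max_ge[OF fin, of k] that unfolding J_def[symmetric] by fastforce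
    then obtain c where c: "c \<noteq> 0" "(tilde_primed n matX ^^ J) f = scl c v"
      using extract_leading[OF a J] by blast
    have "scl c v \<in> N" using closed[OF matXY_sl2(1) f(1), of J] unfolding c(2) .
    then have "scl (1 / c) (scl c v) \<in> N" by (rule subspace_scl[OF sub])
    then have "v \<in> N" using c(1) by simp
    then have "W \<subseteq> N"
      by (intro W_minimal[OF sub] closed matXY_sl2)
    then show ?thesis using NW by blast
  qed
  then show "N = {\<zero>\<^bsub>cfun_module W\<^esub>} \<or> N = carrier (cfun_module W)"
    unfolding cfun_module_simps by blast
qed

end

text \<open>As c is not a natural number, the factor (k + 1)(c - k) never vanishes, so X' recovers
  Y'^k w from Y'^(k+1) w, down to w itself.\<close>

lemma lowering_zero_imp_zero:
  assumes "tilde_primed n matX w = 0" "tilde_primed n matH w = scl c w"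
    and "c \<notin> \<nat>" "(tilde_primed n matY ^^ k) w = 0"
  shows "w = 0"
  using assms(4)
proof (induction k)
  case (Suc k)
  have "scl (of_nat (Suc k) * (c - of_nat k)) ((tilde_primed n matY ^^ k) w) = 0"
    using X_Y_pow[OF assms(1,2), of k] Suc.prems
    by (simp only: clinear_zero[OF clinear_tilde_primed])
  moreover have "of_nat (Suc k) * (c - of_nat k) \<noteq> 0"
    using assms(3) by (auto simp del: of_nat_Suc)
  ultimately show ?case using Suc.IH by simp
qed simp

text \<open>Y'^(m+1) Q is again killed by X', now with the negative weight -m - 2. Since Y' is
  nilpotent for degree reasons, such a vector must be 0.\<close>

lemma harmonic_highest_weight_vector:
  assumes "Q \<in> Dharm n d" "Q \<noteq> 0" "0 \<le> d" "2 * d \<le> int n"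
  shows "highest_weight_vector n (nat (int n - 2 * d)) Q"
proof
  let ?m = "nat (int n - 2 * d)"
  have m: "complex_of_nat ?m = of_nat n - 2 * of_int d"
    using assms(4) by (simp add: of_nat_nat)
  show "Q \<noteq> 0" "tilde_primed n matX Q = 0" using assms Dharm_weight by auto
  show H: "tilde_primed n matH Q = scl (of_nat ?m) Q"
    using Dharm_weight(2)[OF assms(1)] by (simp only: m)
  let ?w = "(tilde_primed n matY ^^ Suc ?m) Q"
  show "?w = 0"
  proof (rule lowering_zero_imp_zero)
    show "tilde_primed n matX ?w = 0"
      \<comment> \<open>The coefficient contains m - m = 0.\<close>
      using X_Y_pow[OF Dharm_weight(1)[OF assms(1)] H, of ?m] by simp
    show "tilde_primed n matH ?w = scl (of_nat ?m - 2 * of_nat (Suc ?m)) ?w"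
      by (rule H_Y_pow[OF H])
    show "complex_of_nat ?m - 2 * of_nat (Suc ?m) \<notin> \<nat>"
    proof
      assume "complex_of_nat ?m - 2 * of_nat (Suc ?m) \<in> \<nat>"
      then obtain k where "complex_of_nat ?m - 2 * of_nat (Suc ?m) = of_nat k" by (auto elim: Nats_cases)
      then have "complex_of_nat ?m = of_nat (k + 2 * Suc ?m)"
        by (simp only: diff_eq_eq of_nat_add of_nat_mult of_nat_numeral)
      then have "?m = k + 2 * Suc ?m" by (simp only: of_nat_eq_iff)
      then show False by simp
    qed
    \<comment> \<open>After n + 1 further steps the degree exceeds n.\<close>
    have "(tilde_primed n matY ^^ Suc n) ?w \<in> Dsp n (d + int (Suc ?m) + int (Suc n))"
      by (intro Dsp_Y_pow Dharm_weight(3) assms)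
    moreover have "Dsp n (d + int (Suc ?m) + int (Suc n)) = {0}"
      by (rule Dsp_trivial) (use assms in simp)
    ultimately show "(tilde_primed n matY ^^ Suc n) ?w = 0" by simp
  qed
qed

section \<open>Symmetric powers\<close>

text \<open>The indicator of J as a point; \<open>undefined\<close> outside the coordinates matches
  the extensional functions in \<open>F2n\<close>.\<close>

definition pt :: "nat \<Rightarrow> nat set \<Rightarrow> nat \<Rightarrow> bit" where
  "pt m J = (\<lambda>j. if j \<in> {1..m} then (if j \<in> J then 1 else 0) else undefined)"

abbreviation delta :: "nat \<Rightarrow> nat set \<Rightarrow> (nat \<Rightarrow> bit) \<Rightarrow> complex" where
  "delta m J \<equiv> ptens m (axis 1 1) (axis 2 1) J"

lemma pt_in_F2n: "pt m J \<in> F2n m"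
  by (auto simp: pt_def F2n_def)

lemma F2n_eq_pt:
  assumes "v \<in> F2n m"
  shows "v = pt m {j \<in> {1..m}. v j = 1}"
proof
  fix j
  show "v j = pt m {j \<in> {1..m}. v j = 1} j"
    using PiE_arb[OF assms[unfolded F2n_def], of j] by (simp add: pt_def)
qed

lemma delta_apply:
  "delta m J v = (if v \<in> F2n m \<and> (\<forall>j\<in>{1..m}. v j = 1 \<longleftrightarrow> j \<in> J) then 1 else 0)"
proof (cases "v \<in> F2n m")
  case True
  have 1: "(if j \<in> J then axis 2 1 else axis 1 1) $ pos (v j) = (if v j = 1 \<longleftrightarrow> j \<in> J then 1 else 0 :: complex)" for j
    by (auto simp: pos_def axis_def)
  show ?thesis
  proof (cases "\<forall>j\<in>{1..m}. v j = 1 \<longleftrightarrow> j \<in> J")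
    case False
    then have "(\<Prod>j\<in>{1..m}. if v j = 1 \<longleftrightarrow> j \<in> J then 1 else 0 :: complex) = 0"
      by (intro prod_zero) auto
    then show ?thesis using False by (simp add: ptens_def pure_tensor_def 1)
  next
    case all: True
    then have "(\<Prod>j\<in>{1..m}. if v j = 1 \<longleftrightarrow> j \<in> J then 1 else 0 :: complex) = 1"
      by (intro prod.neutral) auto
    then show ?thesis using True all by (simp add: ptens_def pure_tensor_def 1)
  qed
qed (simp add: ptens_def pure_tensor_def)

lemma delta_pt:
  assumes "J \<subseteq> {1..m}" "K \<subseteq> {1..m}"
  shows "delta m J (pt m K) = (if J = K then 1 else 0)"
  using assms pt_in_F2n[of m K] by (auto simp: delta_apply pt_def)

lemma subspace_tensor_power: "cfun.subspace (tensor_power m)"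
  by (auto simp: subspace_iff tensor_power_def scl_apply)

lemma delta_in_tensor_power: "delta m J \<in> tensor_power m"
  by (simp add: tensor_power_def delta_apply)

lemma tensor_power_expand:
  assumes "f \<in> tensor_power m"
  shows "f = (\<Sum>J\<in>Pow {1..m}. scl (f (pt m J)) (delta m J))"
proof
  fix v
  show "f v = (\<Sum>J\<in>Pow {1..m}. scl (f (pt m J)) (delta m J)) v"
  proof (cases "v \<in> F2n m")
    case False
    then show ?thesis using assms
      by (simp add: tensor_power_def sum_fun_app scl_apply delta_apply)
  next
    case True
    let ?K = "{j \<in> {1..m}. v j = 1}"
    have "(\<Sum>J\<in>Pow {1..m}. scl (f (pt m J)) (delta m J)) v =
        (\<Sum>J\<in>Pow {1..m}. f (pt m J) * delta m J (pt m ?K))"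
      by (simp only: sum_fun_app scl_apply flip: F2n_eq_pt[OF True])
    also have "\<dots> = (\<Sum>J\<in>Pow {1..m}. if J = ?K then f (pt m J) else 0)"
      by (rule sum.cong[OF refl], subst delta_pt) auto
    also have "\<dots> = f (pt m ?K)"
      by (subst sum.delta) auto
    also have "\<dots> = f v" by (simp only: F2n_eq_pt[OF True, symmetric])
    finally show ?thesis by simp
  qed
qed

lemma F2n_permute:
  assumes "\<sigma> permutes {1..m}"
  shows "v \<circ> \<sigma> \<in> F2n m \<longleftrightarrow> v \<in> F2n m"
proof -
  have "w \<circ> \<tau> \<in> F2n m" if "\<tau> permutes {1..m}" "w \<in> F2n m" for w \<tau>
  proof -
    have "w (\<tau> j) = undefined" if "j \<notin> {1..m}" for j
      using PiE_arb[OF \<open>w \<in> F2n m\<close>[unfolded F2n_def] that] permutes_not_in[OF \<open>\<tau> permutes {1..m}\<close> that]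
      by simp
    then show ?thesis by (auto simp: F2n_def PiE_iff extensional_def)
  qed
  from this[OF assms, of v] this[OF permutes_inv[OF assms], of "v \<circ> \<sigma>"] show ?thesis
    by (auto simp: comp_assoc permutes_inv_o[OF assms])
qed

lemma tensor_power_permute:
  assumes "f \<in> tensor_power m" "\<sigma> permutes {1..m}"
  shows "(\<lambda>v. f (v \<circ> \<sigma>)) \<in> tensor_power m"
  using assms F2n_permute[OF assms(2)] by (simp add: tensor_power_def)

lemma pt_permute:
  assumes "\<sigma> permutes {1..m}"
  shows "pt m J \<circ> \<sigma> = pt m (\<sigma> -` J)"
proof
  fix j
  have "\<sigma> j \<in> {1..m} \<longleftrightarrow> j \<in> {1..m}" by (rule permutes_in_image[OF assms])
  then show "(pt m J \<circ> \<sigma>) j = pt m (\<sigma> -` J) j" by (simp add: pt_def)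
qed

lemma delta_permute:
  assumes "\<sigma> permutes {1..m}"
  shows "(\<lambda>v. delta m J (v \<circ> \<sigma>)) = delta m (\<sigma> ` J)"
proof
  fix v :: "nat \<Rightarrow> bit"
  have "(\<forall>j\<in>{1..m}. (v \<circ> \<sigma>) j = 1 \<longleftrightarrow> j \<in> J) \<longleftrightarrow> (\<forall>i\<in>{1..m}. v i = 1 \<longleftrightarrow> i \<in> \<sigma> ` J)"
    (is "?L \<longleftrightarrow> ?R")
  proof -
    have "?L \<longleftrightarrow> (\<forall>j\<in>{1..m}. v (\<sigma> j) = 1 \<longleftrightarrow> \<sigma> j \<in> \<sigma> ` J)"
      using permutes_inj[OF assms] by (simp add: inj_image_mem_iff)
    also have "\<dots> \<longleftrightarrow> (\<forall>i\<in>\<sigma> ` {1..m}. v i = 1 \<longleftrightarrow> i \<in> \<sigma> ` J)"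
      by (simp only: ball_simps)
    finally show ?thesis by (simp only: permutes_image[OF assms])
  qed
  then show "delta m J (v \<circ> \<sigma>) = delta m (\<sigma> ` J) v"
    by (simp only: delta_apply F2n_permute[OF assms])
qed

text \<open>A bijection from J to K is glued with one between the complements in S and with the
  identity outside S.\<close>

lemma ex_permutes_image:
  assumes "finite S" "J \<subseteq> S" "K \<subseteq> S" "card J = card K"
  obtains \<sigma> where "\<sigma> permutes S" "\<sigma> ` J = K"
proof -
  have fin: "finite J" "finite K"
    by (rule finite_subset[OF assms(2,1)], rule finite_subset[OF assms(3,1)])
  obtain g where g: "bij_betw g J K"
    using finite_same_card_bij[OF fin assms(4)] by blast
  obtain h where h: "bij_betw h (S - J) (S - K)"
    using finite_same_card_bij[of "S - J" "S - K"] assms fin by (auto simp: card_Diff_subset)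
  define \<sigma> where "\<sigma> x = (if x \<in> J then g x else if x \<in> S then h x else x)" for x
  have J: "bij_betw \<sigma> J K"
    using g by (subst bij_betw_cong[of J \<sigma> g]) (simp_all add: \<sigma>_def)
  moreover have "bij_betw \<sigma> (S - J) (S - K)"
    using h by (subst bij_betw_cong[of "S - J" \<sigma> h]) (simp_all add: \<sigma>_def)
  ultimately have "bij_betw \<sigma> (J \<union> (S - J)) (K \<union> (S - K))"
    by (rule bij_betw_combine) blast
  moreover have "J \<union> (S - J) = S" "K \<union> (S - K) = S" using assms(2,3) by blast+
  ultimately have "bij_betw \<sigma> S S" by simp
  then have "\<sigma> permutes S"
    by (rule bij_imp_permutes) (use assms(2) in \<open>auto simp: \<sigma>_def\<close>)
  then show ?thesis using that bij_betw_imp_surj_on[OF J] by blast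
qed

lemma tilde_tensor_power:
  assumes "f \<in> tensor_power m"
  shows "tilde m A f \<in> tensor_power m"
proof -
  have "slot j A f \<in> tensor_power m" if "j \<in> {1..m}" for j
  proof -
    have "v(j := b) \<in> F2n m \<longleftrightarrow> v \<in> F2n m" for v b
      using that by (auto simp: F2n_def PiE_iff extensional_def)
    then show ?thesis using assms by (simp add: tensor_power_def slot_alt)
  qed
  then show ?thesis
    unfolding tilde_def by (intro cfun.subspace_sum[OF subspace_tensor_power])
qed

text \<open>A permutation moves J to an initial segment, so modulo the relations a basis tensor
  depends only on the size of J.\<close>

lemma delta_diff_in_sym_relations:
  assumes "J \<subseteq> {1..m}"
  shows "delta m J - delta m {1..card J} \<in> sym_relations m"
proof -
  have "card J \<le> m" using card_mono[OF _ assms] by simp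
  then obtain \<sigma> where "\<sigma> permutes {1..m}" "\<sigma> ` J = {1..card J}"
    using ex_permutes_image[of "{1..m}" J "{1..card J}"] assms by auto
  then show ?thesis
    unfolding sym_relations_def
    using delta_permute[of \<sigma> m J] delta_in_tensor_power[of m J]
    by (intro cfun.span_base CollectI exI[of _ "delta m J"] exI[of _ \<sigma>]) simp
qed

lemma sum_Pow_card:
  "(\<Sum>J\<in>Pow {1..m}. F J) = (\<Sum>k\<le>m. \<Sum>J\<in>{J \<in> Pow {1..m}. card J = k}. F J)"
  by (rule sum.group[symmetric]) (auto dest: card_mono[rotated])

section \<open>The equivariant map from tensors onto the highest weight module\<close>

context highest_weight_vector
begin

text \<open>On a basis tensor with \<open>k\<close> factors \<open>e\<^sub>2\<close> the value is \<open>(m - k)! Y\<^sup>k v\<close>: the factorial makes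
  the lowering operators match, since such a tensor is lowered in \<open>m - k\<close> ways.\<close>

definition \<psi> :: "((nat \<Rightarrow> bit) \<Rightarrow> complex) \<Rightarrow> (nat \<Rightarrow> bit) \<Rightarrow> complex" where
  "\<psi> f = (\<Sum>J\<in>Pow {1..m}. scl (f (pt m J)) (scl (fact (m - card J)) (y (card J))))"

lemma clinear_\<psi>: "clinear \<psi>"
  unfolding clinear_def
proof (intro conjI allI)
  show "\<psi> (f + g) = \<psi> f + \<psi> g" for f g
    by (simp only: \<psi>_def plus_fun_apply scl_distribs sum.distrib)
  show "\<psi> (scl c f) = scl c (\<psi> f)" for c f
    by (simp only: \<psi>_def scl_apply scl_sum scl_simps mult.assoc)
qed

lemma \<psi>_delta:
  assumes "J \<subseteq> {1..m}"
  shows "\<psi> (delta m J) = scl (fact (m - card J)) (y (card J))"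
proof -
  have "\<psi> (delta m J) = (\<Sum>K\<in>Pow {1..m}. if K = J then scl (fact (m - card J)) (y (card J)) else 0)"
    unfolding \<psi>_def
  proof (rule sum.cong[OF refl])
    fix K assume "K \<in> Pow {1..m}"
    then show "scl (delta m J (pt m K)) (scl (fact (m - card K)) (y (card K))) =
        (if K = J then scl (fact (m - card J)) (y (card J)) else 0)"
      by (cases "K = J") (simp_all only: delta_pt[OF assms] Pow_iff if_True if_False scl_simps refl
          eq_commute[of J K] mult_1 mult_zero_left)
  qed
  also have "\<dots> = scl (fact (m - card J)) (y (card J))"
    using assms by (subst sum.delta) auto
  finally show ?thesis .
qed

text \<open>The three parts of the action are compared separately: m - k ways to add an element give
  (m - k)(m - k - 1)! = (m - k)!, and k ways to remove one give k (m - k + 1)!, matching the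
  coefficient of X' on \<open>y k\<close>.\<close>

lemma \<psi>_act_delta:
  assumes A: "A \<in> sl2" and J: "J \<subseteq> {1..m}"
  shows "\<psi> (tilde m A (delta m J)) = tilde_primed n A (\<psi> (delta m J))"
proof -
  define k where "k = card J"
  have fin: "finite J" using J finite_subset by blast
  have k: "k \<le> m" using card_mono[OF _ J] by (simp add: k_def)
  have A22: "A $ 2 $ 2 = - A $ 1 $ 1" using A by (simp only: sl2_iff)
  have e1: "A *v axis 1 1 = A $ 1 $ 1 *s axis 1 1 + A $ 2 $ 1 *s axis 2 1"
    and e2: "A *v axis 2 1 = A $ 1 $ 2 *s axis 1 1 + A $ 2 $ 2 *s axis 2 1"
    by (simp_all add: vec_eq_iff forall_2 matrix_vector_mult_def UNIV_2 axis_def)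
  have up: "\<psi> (delta m (insert j J)) = scl (fact (m - Suc k)) (y (Suc k))" if "j \<in> {1..m} - J" for j
  proof -
    have "insert j J \<subseteq> {1..m}" "card (insert j J) = Suc k"
      using that J fin by (auto simp: k_def)
    then show ?thesis using \<psi>_delta[of "insert j J"] by (simp only:)
  qed
  have down: "\<psi> (delta m (J - {j})) = scl (fact (m - (k - 1))) (y (k - 1))" if "j \<in> J" for j
  proof -
    have "J - {j} \<subseteq> {1..m}" "card (J - {j}) = k - 1"
      using that J by (auto simp: k_def)
    then show ?thesis using \<psi>_delta[of "J - {j}"] by (simp only:)
  qed
  have "(\<Sum>j\<in>{1..m} - J. \<psi> (delta m (insert j J))) =
      (\<Sum>j\<in>{1..m} - J. scl (fact (m - Suc k)) (y (Suc k)))"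
    by (rule sum.cong[OF refl up])
  also have "\<dots> = scl (of_nat (m - k) * fact (m - Suc k)) (y (Suc k))"
    using J fin by (simp only: sum_const_scl scl_simps card_Diff_subset k_def card_atLeastAtMost diff_Suc_1)
  also have "\<dots> = scl (fact (m - k)) (y (Suc k))"
  proof (cases "k = m")
    \<comment> \<open>Here the factor m - k is zero on the left, while on the right Y'^(m+1) v =
      0.\<close>
    case True
    then show ?thesis by (simp only: Y_top scl_simps)
  next
    case False
    then have "m - k = Suc (m - Suc k)" using k by simp
    then show ?thesis by (simp only: fact_Suc of_nat_mult of_nat_fact)
  qed
  finally have up_sum: "(\<Sum>j\<in>{1..m} - J. \<psi> (delta m (insert j J))) = scl (fact (m - k)) (y (Suc k))" .
  have "(\<Sum>j\<in>J. \<psi> (delta m (J - {j}))) = (\<Sum>j\<in>J. scl (fact (m - (k - 1))) (y (k - 1)))"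
    by (rule sum.cong[OF refl down])
  also have "\<dots> = scl (of_nat k * fact (m - (k - 1))) (y (k - 1))"
    by (simp only: sum_const_scl scl_simps k_def)
  also have "of_nat k * fact (m - (k - 1)) = fact (m - k) * (of_nat k * (of_nat m - of_nat k + 1 :: complex))"
  proof (cases k)
    case (Suc i)
    then have *: "m - (k - 1) = Suc (m - k)" using k by simp
    have "of_nat (m - k) = (of_nat m - of_nat k :: complex)" using k by (rule of_nat_diff)
    then have "of_nat (Suc (m - k)) = (of_nat m - of_nat k + 1 :: complex)" by simp
    then show ?thesis unfolding * fact_Suc by (simp only: of_nat_mult of_nat_fact ac_simps)
  qed simp
  finally have down_sum: "(\<Sum>j\<in>J. \<psi> (delta m (J - {j}))) =
      scl (fact (m - k) * (of_nat k * (of_nat m - of_nat k + 1))) (y (k - 1))" .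
  have diag: "of_nat (m - k) * A $ 1 $ 1 + of_nat k * A $ 2 $ 2 = A $ 1 $ 1 * (of_nat m - 2 * of_nat k)"
    using k by (simp add: A22 of_nat_diff algebra_simps)
  have "\<psi> (tilde m A (delta m J)) =
      scl (of_nat (m - k) * A $ 1 $ 1 + of_nat k * A $ 2 $ 2) (\<psi> (delta m J)) +
      scl (A $ 2 $ 1) (\<Sum>j\<in>{1..m} - J. \<psi> (delta m (insert j J))) +
      scl (A $ 1 $ 2) (\<Sum>j\<in>J. \<psi> (delta m (J - {j})))"
    unfolding tilde_ptens[OF J e1 e2]
    by (simp only: clinear_add[OF clinear_\<psi>] clinear_scl[OF clinear_\<psi>] clinear_sum[OF clinear_\<psi>] k_def)
  also have "\<dots> = scl (A $ 1 $ 1 * (of_nat m - 2 * of_nat k)) (scl (fact (m - k)) (y k)) +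
      scl (A $ 2 $ 1) (scl (fact (m - k)) (y (Suc k))) +
      scl (A $ 1 $ 2) (scl (fact (m - k) * (of_nat k * (of_nat m - of_nat k + 1))) (y (k - 1)))"
    by (simp only: up_sum down_sum diag \<psi>_delta[OF J, folded k_def])
  also have "\<dots> = tilde_primed n A (scl (fact (m - k)) (y k))"
    by (simp only: clinear_scl[OF clinear_tilde_primed] act_y[OF A] scl_distribs scl_simps ac_simps)
  finally show ?thesis by (simp only: \<psi>_delta[OF J] k_def)
qed

lemma \<psi>_act:
  assumes A: "A \<in> sl2" and f: "f \<in> tensor_power m"
  shows "\<psi> (tilde m A f) = tilde_primed n A (\<psi> f)"
proof -
  let ?f = "\<Sum>J\<in>Pow {1..m}. scl (f (pt m J)) (delta m J)"
  have "\<psi> (tilde m A ?f) = (\<Sum>J\<in>Pow {1..m}. scl (f (pt m J)) (\<psi> (tilde m A (delta m J))))"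
    by (simp only: clinear_sum[OF clinear_tilde] clinear_scl[OF clinear_tilde]
        clinear_sum[OF clinear_\<psi>] clinear_scl[OF clinear_\<psi>])
  also have "\<dots> = (\<Sum>J\<in>Pow {1..m}. scl (f (pt m J)) (tilde_primed n A (\<psi> (delta m J))))"
    by (rule sum.cong[OF refl]) (simp only: \<psi>_act_delta[OF A] Pow_iff)
  also have "\<dots> = tilde_primed n A (\<psi> ?f)"
    by (simp only: clinear_sum[OF clinear_tilde_primed] clinear_scl[OF clinear_tilde_primed]
        clinear_sum[OF clinear_\<psi>] clinear_scl[OF clinear_\<psi>])
  finally show ?thesis by (simp only: tensor_power_expand[OF f, symmetric])
qed

lemma \<psi>_image: "\<psi> ` tensor_power m = W"
proof
  have "\<psi> f \<in> W" for f
    unfolding \<psi>_def by (intro cfun.subspace_sum[OF subspace_W] subspace_scl[OF subspace_W] y_in_W)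
  then show "\<psi> ` tensor_power m \<subseteq> W" by blast
  show "W \<subseteq> \<psi> ` tensor_power m"
  proof (rule W_minimal)
    show "cfun.subspace (\<psi> ` tensor_power m)"
      by (rule subspace_clinear_image[OF clinear_\<psi> subspace_tensor_power])
    fix k assume k: "k \<le> m"
    have "\<psi> (scl (1 / fact (m - k)) (delta m {1..k})) = y k"
      using \<psi>_delta[of "{1..k}"] k by (simp add: clinear_scl[OF clinear_\<psi>])
    then show "y k \<in> \<psi> ` tensor_power m"
      using subspace_scl[OF subspace_tensor_power delta_in_tensor_power] by (metis imageI)
  qed
qed

text \<open>A permutation of the positions permutes the subsets of each given size, and the weights
  in \<open>\<psi>\<close> depend only on that size.\<close>

lemma \<psi>_permute:
  assumes "\<sigma> permutes {1..m}"
  shows "\<psi> (\<lambda>v. f (v \<circ> \<sigma>)) = \<psi> f"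
proof -
  have inj: "inj \<sigma>" and surj: "surj \<sigma>" using assms permutes_inj permutes_surj by blast+
  have card: "card (\<sigma> -` J) = card J" for J
    using card_vimage_inj[OF inj, of J] surj by simp
  have "bij_betw (\<lambda>J. \<sigma> -` J) (Pow {1..m}) (Pow {1..m})"
  proof (rule bij_betw_byWitness[where f' = "\<lambda>J. \<sigma> ` J"])
    show "\<forall>J\<in>Pow {1..m}. \<sigma> ` (\<sigma> -` J) = J" using surj by (simp add: surj_image_vimage_eq)
    show "\<forall>J\<in>Pow {1..m}. \<sigma> -` (\<sigma> ` J) = J" using inj by (simp add: inj_vimage_image_eq)
    show "(\<lambda>J. \<sigma> -` J) ` Pow {1..m} \<subseteq> Pow {1..m}" using permutes_in_image[OF assms] by blast
    show "(\<lambda>J. \<sigma> ` J) ` Pow {1..m} \<subseteq> Pow {1..m}" using permutes_in_image[OF assms] by blast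
  qed
  from sum.reindex_bij_betw[OF this, of "\<lambda>J. scl (f (pt m J)) (scl (fact (m - card J)) (y (card J)))"]
  show ?thesis
    by (simp only: \<psi>_def pt_permute[OF assms] card)
qed

text \<open>Invariance under permutations kills the relations. Conversely, independence of the
  \<open>y k\<close> forces the coefficients of f over all J of each size to sum to zero, which
  makes f a combination of differences of basis tensors of equal weight.\<close>

lemma \<psi>_kernel: "sym_relations m = {f \<in> tensor_power m. \<psi> f = 0}"
proof
  have sub: "cfun.subspace {f \<in> tensor_power m. \<psi> f = 0}"
    using subspace_tensor_power[of m]
    by (simp add: subspace_iff clinear_zero[OF clinear_\<psi>] clinear_add[OF clinear_\<psi>] clinear_scl[OF clinear_\<psi>])
  show "sym_relations m \<subseteq> {f \<in> tensor_power m. \<psi> f = 0}"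
    unfolding sym_relations_def
  proof (rule cfun.span_minimal[OF _ sub], rule subsetI, elim CollectE exE conjE)
    fix g f \<sigma>
    assume g: "g = f - (\<lambda>v. f (v \<circ> \<sigma>))" and f: "f \<in> tensor_power m" and \<sigma>: "\<sigma> permutes {1..m}"
    have "g \<in> tensor_power m"
      unfolding g by (intro cfun.subspace_diff[OF subspace_tensor_power] tensor_power_permute f \<sigma>)
    moreover have "\<psi> g = 0"
      unfolding g clinear_diff[OF clinear_\<psi>] \<psi>_permute[OF \<sigma>] by (rule diff_self)
    ultimately show "g \<in> {f \<in> tensor_power m. \<psi> f = 0}" by blast
  qed
  show "{f \<in> tensor_power m. \<psi> f = 0} \<subseteq> sym_relations m"
  proof
    fix f assume "f \<in> {f \<in> tensor_power m. \<psi> f = 0}"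
    then have f: "f \<in> tensor_power m" "\<psi> f = 0" by auto
    define s where "s k = (\<Sum>J\<in>{J \<in> Pow {1..m}. card J = k}. f (pt m J))" for k
    have group: "(\<Sum>J\<in>Pow {1..m}. scl (f (pt m J)) (F (card J))) = (\<Sum>k\<le>m. scl (s k) (F k))"
      for F :: "nat \<Rightarrow> (nat \<Rightarrow> bit) \<Rightarrow> complex"
      unfolding sum_Pow_card s_def sum_scl[symmetric]
      by (intro sum.cong refl) auto
    have "(\<Sum>k\<le>m. scl (s k * fact (m - k)) (y k)) = 0"
      using f(2) group[of "\<lambda>k. scl (fact (m - k)) (y k)"] by (simp only: \<psi>_def scl_simps)
    then have "s k = 0" if "k \<le> m" for k
      using y_independent[of "\<lambda>k. s k * fact (m - k)" k] that by simp
    \<comment> \<open>Replacing each basis tensor by the representative of its weight collects the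
      coefficients into the sums \<open>s k\<close>, which are zero; subtracting this expression
      therefore changes nothing.\<close>
    then have zero: "(\<Sum>J\<in>Pow {1..m}. scl (f (pt m J)) (delta m {1..card J})) = 0"
      unfolding group[of "\<lambda>k. delta m {1..k}"] by (intro sum.neutral) auto
    have "f = (\<Sum>J\<in>Pow {1..m}. scl (f (pt m J)) (delta m J)) -
        (\<Sum>J\<in>Pow {1..m}. scl (f (pt m J)) (delta m {1..card J}))"
      unfolding zero using tensor_power_expand[OF f(1)] by (simp only: diff_zero)
    also have "\<dots> = (\<Sum>J\<in>Pow {1..m}. scl (f (pt m J)) (delta m J - delta m {1..card J}))"
      by (simp only: scl_distribs sum_subtractf)
    also have "\<dots> \<in> sym_relations m"
    proof -
      have "cfun.subspace (sym_relations m)" by (simp only: sym_relations_def cfun.subspace_span)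
      then show ?thesis
        by (intro cfun.subspace_sum subspace_scl delta_diff_in_sym_relations) auto
    qed
    finally show "f \<in> sym_relations m" .
  qed
qed

lemma sl2_isomorphic_sym_power:
  "sl2_isomorphic (cfun_module W) (tilde_primed n) (sym_power m) (sym_action m)"
  unfolding sym_power_def sym_action_def
  by (rule sl2_isomorphic_quotient[OF sl2_module_W subspace_W subspace_tensor_power clinear_\<psi> \<psi>_image
        \<psi>_kernel])
    (simp_all only: tilde_tensor_power \<psi>_act)

end

theorem proposition4p4:
  fixes n :: nat and d :: int
  assumes "n \<ge> 1" and "0 \<le> d" and "of_int d \<le> real n / 2"
  shows "tilde_primed n matX ` Dsp n d = Dsp n (d - 1) \<and>
    (is_direct_sum (Dsp n d) {0..nat d} (Dpiece n d) \<and>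
     is_direct_sum2 (Dsp n d) (Dharm n d) (tilde_primed n matY ` Dsp n (d - 1))) \<and>
    (\<forall>Q \<in> Dharm n d. Q \<noteq> 0 \<longrightarrow>
       (let m = nat (int n - 2 * d);
            W = cfun.span {(tilde_primed n matY ^^ j) Q | j. j \<in> {0..m}}
        in sl2_irreducible (cfun_module W) (tilde_primed n) \<and>
           sl2_isomorphic (cfun_module W) (tilde_primed n) (sym_power m) (sym_action m))) \<and>
    (int (cfun.dim (Dharm n d)) = int (cfun.dim (Dsp n d)) - int (cfun.dim (Dsp n (d - 1))) \<and>
     int (cfun.dim (Dsp n d)) - int (cfun.dim (Dsp n (d - 1))) = binom n d - binom n (d - 1))"
proof -
  have "real_of_int (2 * d) \<le> real_of_int (int n)" using assms(3) by simp
  then have d: "2 * d \<le> int n" by (simp only: of_int_le_iff)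
  have "is_direct_sum (Dsp n d) {0..nat d} (Dpiece n d)"
    using direct_sum_Dpiece[of "nat d" n] d assms(2) by simp
  moreover have "\<forall>Q \<in> Dharm n d. Q \<noteq> 0 \<longrightarrow>
       (let m = nat (int n - 2 * d);
            W = cfun.span {(tilde_primed n matY ^^ j) Q | j. j \<in> {0..m}}
        in sl2_irreducible (cfun_module W) (tilde_primed n) \<and>
           sl2_isomorphic (cfun_module W) (tilde_primed n) (sym_power m) (sym_action m))"
  proof (intro ballI impI)
    fix Q assume "Q \<in> Dharm n d" "Q \<noteq> 0"
    \<comment> \<open>With m = n - 2d, the space \<open>W\<close> of the locale is the span of the
      powers of Y' applied to Q.\<close>
    then interpret highest_weight_vector n "nat (int n - 2 * d)" Q
      using harmonic_highest_weight_vector assms(2) d by blast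
    show "let m = nat (int n - 2 * d);
            W = cfun.span {(tilde_primed n matY ^^ j) Q | j. j \<in> {0..m}}
        in sl2_irreducible (cfun_module W) (tilde_primed n) \<and>
           sl2_isomorphic (cfun_module W) (tilde_primed n) (sym_power m) (sym_action m)"
      using sl2_irreducible_W sl2_isomorphic_sym_power unfolding W_def Let_def by blast
  qed
  ultimately show ?thesis
    using X_image_Dsp[OF d] direct_sum_harmonic_Y[OF d] dim_Dharm[OF d] dim_Dsp[of n d] dim_Dsp[of n "d - 1"]
    by linarith
qed

end
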